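(* Let $t\ge 0$ with $2t\le n$, let $d_1,\dots,d_t\in\mathbb{Q}/\mathbb{Z}$ be non-zero, let $D=D_n(d_1,\dots,d_t)$, let $\gamma_i=e^{2\pi\sqrt{-1}\,d_i}$ for $1\le i\le t$, and let $\sigma(D)=\prod_{i=1}^t|d_i|$. Then $B_n(U(m))_D$ is non-empty if and only if $\sigma(D)$ divides $m$. In that case, let $l=m/\sigma(D)\in\mathbb{N}$ and $(A_1,\dots,A_n)\in B_n(U(m))_D$. Then there exist orthonormal vectors $v_1,\dots,v_l\in\mathbb{C}^m$ and $\alpha_{i'j},\beta_{ij}\in\mathbb{S}^1\subset\mathbb{C}$ for $1\le i\le t<i'\le n$ and $1\le j\le l$ such that (1) $\{A_1^{p_1}A_2^{p_2}\cdots A_t^{p_t}v_j \mid 0\le p_i<|d_i|\text{ for }1\le i\le t,\ 1\le j\le l\}$ is an orthonormal basis of $\mathbb{C}^m$; (2) $A_1^{p_1}\cdots A_t^{p_t}v_j$ is an eigenvector of $A_i$ with eigenvalue $\gamma_{i-t}^{p_{i-t}}\alpha_{ij}$ for $t+1\le i\le 2t$, and an eigenvector of $A_i$ with eigenvalue $\alpha_{ij}$ for $2t+1\le i\le n$; (3) $A_i^{|d_i|}v_j=\beta_{ij}v_j$ for $1\le i\le t$.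
   Context: $U(m)$ is the unitary group and $[A,B]=ABA^{-1}B^{-1}$. For $d\in\mathbb{Q}/\mathbb{Z}$, $|d|$ denotes its order in the group $\mathbb{Q}/\mathbb{Z}$. $D_n(d_1,\dots,d_t)=(d_{ij})$ is the $n\times n$ matrix over $\mathbb{Q}/\mathbb{Z}$ with $d_{k+t,k}=d_k$, $d_{k,k+t}=-d_k$ for $1\le k\le t$, and all other entries $0$. $B_n(U(m))_D$ is the space of $n$-tuples $(A_1,\dots,A_n)\in U(m)^n$ with $[A_i,A_j]=e^{2\pi\sqrt{-1}\,d_{ij}}I_m$ for all $1\le i,j\le n$. *)

theory Defs
  imports
    Complex_Main
    "Jordan_Normal_Form.Char_Poly"
    "Jordan_Normal_Form.Schur_Decomposition"
    "Jordan_Normal_Form.VS_Connect"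
begin

quotient_type rat_mod_int = rat / "\<lambda>x y. x - y \<in> \<int>"
proof (rule equivpI)
  show "reflp (\<lambda>x y :: rat. x - y \<in> \<int>)"
    by (simp add: reflp_def)
  show "symp (\<lambda>x y :: rat. x - y \<in> \<int>)"
    by (metis (no_types, lifting) Ints_minus minus_diff_eq sympI)
  show "transp (\<lambda>x y :: rat. x - y \<in> \<int>)"
    by (metis (no_types, lifting) Ints_add diff_add_cancel add_diff_eq transpI)
qed

instantiation rat_mod_int :: ab_group_add
begin

lift_definition zero_rat_mod_int :: rat_mod_int is "0" .

lift_definition plus_rat_mod_int :: "rat_mod_int \<Rightarrow> rat_mod_int \<Rightarrow> rat_mod_int" is "(+)"
  by (metis (no_types, lifting) Ints_add add_diff_add)

lift_definition uminus_rat_mod_int :: "rat_mod_int \<Rightarrow> rat_mod_int" is "uminus"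
  by (metis (no_types, lifting) Ints_minus minus_diff_minus)

lift_definition minus_rat_mod_int :: "rat_mod_int \<Rightarrow> rat_mod_int \<Rightarrow> rat_mod_int" is "(-)"
  by (metis (no_types, lifting) Ints_diff diff_diff_eq diff_diff_eq2 diff_add_eq add.commute)

instance
  by standard (transfer, simp)+

end

lift_definition exp_2pi_i :: "rat_mod_int \<Rightarrow> complex"
  is "\<lambda>q. exp (2 * of_real pi * \<i> * of_rat q)"
proof -
  fix x y :: rat
  assume "x - y \<in> \<int>"
  then obtain k :: int where "x = y + of_int k"
    by (metis Ints_cases diff_add_cancel add.commute)
  then have "exp (2 * of_real pi * \<i> * of_rat x)
      = exp (2 * of_real pi * \<i> * of_rat y) * cis (2 * pi * of_int k)"
    by (simp add: of_rat_add exp_add cis_conv_exp algebra_simps)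
  moreover have "cis (2 * pi * of_int k) = 1"
    by (rule cis_multiple_2pi) simp
  ultimately show "exp (2 * of_real pi * \<i> * of_rat x) = exp (2 * of_real pi * \<i> * of_rat y :: complex)"
    by simp
qed

text \<open>The order of an element in the additive group; it is finite by the lemma that follows.\<close>

definition qz_order :: "rat_mod_int \<Rightarrow> nat"
  where "qz_order d = (LEAST k. 0 < k \<and> (\<Sum>i<k. d) = 0)"

lemma qz_order_exists: "\<exists>k::nat. 0 < k \<and> (\<Sum>i<k. d) = (0 :: rat_mod_int)"
proof -
  obtain q where d: "d = abs_rat_mod_int q"
    by (metis Quotient_abs_rep Quotient_rat_mod_int)
  obtain a b where q: "quotient_of q = (a, b)"
    by force
  then have b: "b > 0" and qab: "q = of_int a / of_int b"
    by (simp_all add: quotient_of_denom_pos quotient_of_div)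
  have *: "(\<Sum>i<k. d) = abs_rat_mod_int (of_nat k * q)" for k
    by (induction k)
       (simp_all add: d zero_rat_mod_int_def plus_rat_mod_int.abs_eq algebra_simps)
  have "of_nat (nat b) * q = of_int a"
    using b by (simp add: qab)
  then have "(\<Sum>i<nat b. d) = 0"
    by (simp add: * zero_rat_mod_int_def rat_mod_int.abs_eq_iff)
  then show ?thesis
    using b by (intro exI[of _ "nat b"]) simp
qed

text \<open>An \<open>n\<close> by \<open>n\<close> matrix over \<open>rat_mod_int\<close> is a function of two indices, of which only the values on
  \<open>{1..n}\<close> matter; for \<open>2 * t \<le> n\<close> all nonzero entries below have their indices in that range.\<close>

definition D_matrix :: "nat \<Rightarrow> (nat \<Rightarrow> rat_mod_int) \<Rightarrow> nat \<Rightarrow> nat \<Rightarrow> rat_mod_int" where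
  "D_matrix t d i j =
     (if j \<in> {1..t} \<and> i = j + t then d j
      else if i \<in> {1..t} \<and> j = i + t then - d i
      else 0)"

definition unitary_group :: "nat \<Rightarrow> complex mat monoid" where
  "unitary_group m =
     \<lparr>carrier = {A \<in> carrier_mat m m. A * mat_adjoint A = 1\<^sub>m m \<and> mat_adjoint A * A = 1\<^sub>m m},
      monoid.mult = (*), one = 1\<^sub>m m\<rparr>"

definition commutator :: "('a, 'b) monoid_scheme \<Rightarrow> 'a \<Rightarrow> 'a \<Rightarrow> 'a" where
  "commutator G a b = a \<otimes>\<^bsub>G\<^esub> b \<otimes>\<^bsub>G\<^esub> inv\<^bsub>G\<^esub> a \<otimes>\<^bsub>G\<^esub> inv\<^bsub>G\<^esub> b"

definition almost_commuting_tuples ::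
    "nat \<Rightarrow> nat \<Rightarrow> (nat \<Rightarrow> nat \<Rightarrow> rat_mod_int) \<Rightarrow> (nat \<Rightarrow> complex mat) set" where
  "almost_commuting_tuples n m D =
     {A \<in> {1..n} \<rightarrow>\<^sub>E carrier (unitary_group m).
        \<forall>i\<in>{1..n}. \<forall>j\<in>{1..n}.
          commutator (unitary_group m) (A i) (A j) = exp_2pi_i (D i j) \<cdot>\<^sub>m 1\<^sub>m m}"

text \<open>The ordered product \<open>A 1 ^ p 1 * \<dots> * A t ^ p t\<close> of matrices of size \<open>m\<close>.\<close>

definition power_product ::
    "nat \<Rightarrow> (nat \<Rightarrow> complex mat) \<Rightarrow> nat \<Rightarrow> (nat \<Rightarrow> nat) \<Rightarrow> complex mat" where
  "power_product m A t p = foldr (\<lambda>i M. (A i ^\<^sub>m p i) * M) [1..<Suc t] (1\<^sub>m m)"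

definition orthonormal :: "complex vec set \<Rightarrow> bool" where
  "orthonormal S \<longleftrightarrow> (\<forall>u\<in>S. \<forall>w\<in>S. u \<bullet>c w = (if u = w then 1 else 0))"

definition orthonormal_basis :: "nat \<Rightarrow> complex vec set \<Rightarrow> bool" where
  "orthonormal_basis m S \<longleftrightarrow>
     orthonormal S \<and> vectorspace.basis class_ring (module_vec TYPE(complex) m) S"

end

theory Submission
  imports Defs
begin

text \<open>
  The matrices \<open>A i\<close> with \<open>i > t\<close> and the powers \<open>A i ^ |d i|\<close> with \<open>i \<le> t\<close> all commute. For a common
  unit eigenvector \<open>v\<close> of these, the \<open>\<sigma>\<close> translates \<open>A 1 ^ p 1 \<dots> A t ^ p t v\<close> are pairwise orthogonal,
  since \<open>A (i + t)\<close> has pairwise distinct eigenvalues on vectors with different \<open>p i\<close>. They are permuted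
  up to scalars by every \<open>A i\<close>, so that the orthogonal complement of their span is invariant and, if it
  is nonzero, contains a further common eigenvector. A maximal family of such vectors has \<open>m / \<sigma>\<close>
  members. Conversely, if \<open>\<sigma>\<close> divides \<open>m\<close>, clock and shift matrices give an element of the space.
\<close>

section \<open>Roots of unity and unitary matrices\<close>

text \<open>For \<open>i \<le> t\<close> and \<open>d i \<noteq> 0\<close>, the matrices
  \<open>A i\<close> and \<open>A (i + t)\<close> have no eigenvector in common: on such a vector
  the relation \<open>A (i + t) * A i = \<gamma> A i * A (i + t)\<close> would force \<gamma> = 1.
  This is why only a power of \<open>A i\<close> may be asked to fix the line of \<open>v\<close>,
  and |d i| is the least positive exponent k with \<gamma>^k = 1, which is what lets the power
  commute with \<open>A (i + t)\<close>. New eigenvectors must be found inside an orthogonal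
  complement. Instead of writing the restriction of a matrix in a basis of that subspace, the
  argument uses an annihilating polynomial of a single vector, so that everything it produces stays
  in the subspace by invariance. Divisibility is then forced by counting: k vectors yield exactly
  k\<sigma> orthonormal translates, so k\<sigma> never exceeds m, while any k with k\<sigma> < m
  admits one vector more. The process can only end with k\<sigma> equal to m.\<close>

lemma exp_2pi_i_add: "exp_2pi_i (x + y) = exp_2pi_i x * exp_2pi_i y"
  by transfer (simp add: of_rat_add exp_add algebra_simps)

lemma of_real_of_rat_eq: "complex_of_real (of_rat q) = of_rat q"
  by (cases q) (simp add: of_rat_rat)

lemma exp_2pi_i_eq_1_iff: "exp_2pi_i x = 1 \<longleftrightarrow> x = 0"
proof transfer
  fix q :: rat
  have "exp (2 * of_real pi * \<i> * of_rat q :: complex) = cis (2 * pi * of_rat q)"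
    by (simp add: cis_conv_exp of_real_of_rat_eq mult_ac)
  also have "\<dots> = 1 \<longleftrightarrow> cos (2 * pi * real_of_rat q) = 1"
    by (metis cis.sel(1) cis_2pi cis_multiple_2pi complex.sel(1) cos_one_2pi_int Ints_of_int
        mult.commute mult.left_commute one_complex.sel(1))
  also have "\<dots> \<longleftrightarrow> (\<exists>k::int. of_rat q = (of_int k :: real))"
    by (subst cos_one_2pi_int) (simp add: mult.commute[of _ "2 * pi"] mult.assoc)
  also have "\<dots> \<longleftrightarrow> q \<in> \<int>"
    by (metis Ints_cases Ints_of_int of_rat_eq_iff of_rat_of_int_eq)
  finally show "exp (2 * of_real pi * \<i> * of_rat q :: complex) = 1 \<longleftrightarrow> q - 0 \<in> \<int>"
    by simp
qed

lemma exp_2pi_i_0 [simp]: "exp_2pi_i 0 = 1"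
  by (simp add: exp_2pi_i_eq_1_iff)

lemma exp_2pi_i_minus_mult: "exp_2pi_i (- x) * exp_2pi_i x = 1"
  by (metis exp_2pi_i_add exp_2pi_i_0 add.left_inverse)

lemma norm_exp_2pi_i [simp]: "cmod (exp_2pi_i x) = 1"
  by transfer (simp add: norm_exp_eq_Re flip: of_real_of_rat_eq)

lemma exp_2pi_i_sum: "exp_2pi_i (\<Sum>i<k. x) = exp_2pi_i x ^ k"
  by (induction k) (simp_all add: exp_2pi_i_add)

lemma qz_order_pos: "0 < qz_order d"
  and exp_2pi_i_power_qz_order: "exp_2pi_i d ^ qz_order d = 1"
proof -
  have "0 < qz_order d \<and> (\<Sum>i<qz_order d. d) = 0"
    unfolding qz_order_def by (rule LeastI_ex) (rule qz_order_exists)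
  then show "0 < qz_order d" "exp_2pi_i d ^ qz_order d = 1"
    by (simp_all add: exp_2pi_i_sum[symmetric])
qed

text \<open>Two equal powers would have quotient 1, making a smaller positive multiple of
  \<open>d\<close> vanish, against the minimality of the order. This is what separates the
  eigenvalues on different translates.\<close>

lemma exp_2pi_i_power_inj:
  assumes "a < qz_order d" "b < qz_order d" "exp_2pi_i d ^ a = exp_2pi_i d ^ b"
  shows "a = b"
proof -
  have False if "a < b" "b < qz_order d" "exp_2pi_i d ^ a = exp_2pi_i d ^ b" for a b
  proof -
    have "exp_2pi_i d ^ b = exp_2pi_i d ^ a * exp_2pi_i d ^ (b - a)"
      using that(1) by (simp flip: power_add)
    moreover have "exp_2pi_i d \<noteq> 0"
      by (metis norm_exp_2pi_i norm_zero zero_neq_one)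
    ultimately have "exp_2pi_i d ^ (b - a) = 1"
      using that by simp
    then have "(\<Sum>i<b - a. d) = 0"
      by (simp only: exp_2pi_i_sum[symmetric] exp_2pi_i_eq_1_iff)
    then have "qz_order d \<le> b - a"
      unfolding qz_order_def using that by (intro Least_le) simp
    then show False using that by simp
  qed
  then show ?thesis using assms by (metis linorder_neqE_nat)
qed

section \<open>Adjoints and the unitary group\<close>

lemma mat_adjoint_dim [simp]:
  "dim_row (mat_adjoint A) = dim_col A" "dim_col (mat_adjoint A) = dim_row A"
  by (simp_all add: mat_adjoint_def)

lemma mat_adjoint_index:
  "i < dim_col A \<Longrightarrow> j < dim_row A \<Longrightarrow> mat_adjoint A $$ (i, j) = conjugate (A $$ (j, i))"
  by (simp add: mat_adjoint_def mat_of_rows_index)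

lemma mat_adjoint_carrier [simp]:
  "A \<in> carrier_mat n m \<Longrightarrow> mat_adjoint A \<in> carrier_mat m n"
  by (rule carrier_matI) simp_all

lemma mat_adjoint_mult:
  assumes A: "A \<in> carrier_mat n m" and B: "B \<in> carrier_mat m k"
  shows "mat_adjoint (A * B) = mat_adjoint B * mat_adjoint A"
proof (rule eq_matI)
  fix i j assume ij: "i < dim_row (mat_adjoint B * mat_adjoint A)"
    "j < dim_col (mat_adjoint B * mat_adjoint A)"
  then have "mat_adjoint (A * B) $$ (i, j) = conjugate (\<Sum>r<m. A $$ (j, r) * B $$ (r, i))"
    using A B by (simp add: mat_adjoint_index scalar_prod_def atLeast0LessThan)
  also have "\<dots> = (\<Sum>r<m. conjugate (B $$ (r, i)) * conjugate (A $$ (j, r)))"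
    unfolding sum_conjugate[OF finite_lessThan]
    by (rule sum.cong) (simp_all add: conjugate_dist_mul mult.commute)
  also have "\<dots> = (mat_adjoint B * mat_adjoint A) $$ (i, j)"
    using A B ij by (simp add: mat_adjoint_index scalar_prod_def atLeast0LessThan)
  finally show "mat_adjoint (A * B) $$ (i, j) = (mat_adjoint B * mat_adjoint A) $$ (i, j)" .
qed (use A B in auto)

lemma mat_adjoint_adjoint [simp]: "mat_adjoint (mat_adjoint A) = A"
  by (intro eq_matI) (auto simp: mat_adjoint_index)

lemma mat_adjoint_one [simp]: "mat_adjoint (1\<^sub>m n :: complex mat) = 1\<^sub>m n"
  by (intro eq_matI) (auto simp: mat_adjoint_index)

lemma cscalar_prod_mult_mat_vec:
  assumes "A \<in> carrier_mat n m" "u \<in> carrier_vec m" "w \<in> carrier_vec n"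
  shows "(A *\<^sub>v u) \<bullet>c w = u \<bullet>c (mat_adjoint A *\<^sub>v w)"
proof -
  have "(A *\<^sub>v u) \<bullet>c w = (\<Sum>i<n. \<Sum>j<m. A $$ (i, j) * u $ j * conjugate (w $ i))"
    using assms by (simp add: scalar_prod_def sum_distrib_right atLeast0LessThan)
  also have "\<dots> = (\<Sum>j<m. \<Sum>i<n. A $$ (i, j) * u $ j * conjugate (w $ i))"
    by (rule sum.swap)
  also have "\<dots> = u \<bullet>c (mat_adjoint A *\<^sub>v w)"
    using assms
    by (simp add: scalar_prod_def sum_distrib_left atLeast0LessThan mat_adjoint_index
        sum_conjugate conjugate_dist_mul mult_ac)
  finally show ?thesis .
qed

lemma unitary_groupD:
  assumes "A \<in> carrier (unitary_group m)"
  shows "A \<in> carrier_mat m m" "A * mat_adjoint A = 1\<^sub>m m" "mat_adjoint A * A = 1\<^sub>m m"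
  using assms by (auto simp: unitary_group_def)

lemma unitary_group_adjoint:
  "A \<in> carrier (unitary_group m) \<Longrightarrow> mat_adjoint A \<in> carrier (unitary_group m)"
  by (auto simp: unitary_group_def)

lemma unitary_group_one: "1\<^sub>m m \<in> carrier (unitary_group m)"
  by (simp add: unitary_group_def)

lemma unitary_group_mult:
  assumes A: "A \<in> carrier (unitary_group m)" and B: "B \<in> carrier (unitary_group m)"
  shows "A * B \<in> carrier (unitary_group m)"
proof -
  note [simp] = unitary_groupD[OF A] unitary_groupD[OF B] mult_carrier_mat[of _ m m _ m]
    left_mult_one_mat[of _ m m] right_mult_one_mat[of _ m m]
  have "A * B * (mat_adjoint B * mat_adjoint A) = A * (B * (mat_adjoint B * mat_adjoint A))"
    by (rule assoc_mult_mat[of _ m m _ m _ m]) auto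
  also have "B * (mat_adjoint B * mat_adjoint A) = B * mat_adjoint B * mat_adjoint A"
    by (rule assoc_mult_mat[of _ m m _ m _ m, symmetric]) auto
  finally have 1: "A * B * (mat_adjoint B * mat_adjoint A) = 1\<^sub>m m"
    by simp
  have "mat_adjoint B * mat_adjoint A * (A * B) = mat_adjoint B * (mat_adjoint A * (A * B))"
    by (rule assoc_mult_mat[of _ m m _ m _ m]) auto
  also have "mat_adjoint A * (A * B) = mat_adjoint A * A * B"
    by (rule assoc_mult_mat[of _ m m _ m _ m, symmetric]) auto
  finally have 2: "mat_adjoint B * mat_adjoint A * (A * B) = 1\<^sub>m m"
    by simp
  from 1 2 show ?thesis
    by (simp add: unitary_group_def mat_adjoint_mult[of _ m m _ m])
qed

lemma unitary_group_pow:
  assumes "A \<in> carrier (unitary_group m)"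
  shows "A ^\<^sub>m k \<in> carrier (unitary_group m)"
  using assms unitary_groupD(1)[OF assms]
  by (induction k) (auto intro: unitary_group_one unitary_group_mult)

lemma group_unitary_group: "group (unitary_group m)"
proof (rule groupI)
  fix A B C assume "A \<in> carrier (unitary_group m)" "B \<in> carrier (unitary_group m)"
    "C \<in> carrier (unitary_group m)"
  then show "A \<otimes>\<^bsub>unitary_group m\<^esub> B \<otimes>\<^bsub>unitary_group m\<^esub> C
      = A \<otimes>\<^bsub>unitary_group m\<^esub> (B \<otimes>\<^bsub>unitary_group m\<^esub> C)"
    by (simp add: unitary_group_def assoc_mult_mat[of _ m m _ m _ m])
next
  fix A assume A: "A \<in> carrier (unitary_group m)"
  show "\<exists>B\<in>carrier (unitary_group m). B \<otimes>\<^bsub>unitary_group m\<^esub> A = \<one>\<^bsub>unitary_group m\<^esub>"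
    using unitary_groupD(3)[OF A] unitary_group_adjoint[OF A]
    by (auto simp: unitary_group_def)
qed (use unitary_group_one unitary_group_mult in \<open>auto simp: unitary_group_def\<close>)

lemma inv_unitary_group:
  assumes "A \<in> carrier (unitary_group m)"
  shows "inv\<^bsub>unitary_group m\<^esub> A = mat_adjoint A"
  using assms unitary_groupD(3)[OF assms]
  by (intro group.inv_equality[OF group_unitary_group] unitary_group_adjoint)
    (simp_all add: unitary_group_def)

text \<open>The product of the two adjoints is the inverse of \<open>B * A\<close>. All later
  arguments use the inverse-free relation on the right instead of the group commutator.\<close>

lemma commutator_eq_scalar_iff:
  assumes A: "A \<in> carrier (unitary_group m)" and B: "B \<in> carrier (unitary_group m)"
  shows "commutator (unitary_group m) A B = z \<cdot>\<^sub>m 1\<^sub>m m \<longleftrightarrow> A * B = z \<cdot>\<^sub>m (B * A)"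
proof -
  note [simp] = unitary_groupD[OF A] unitary_groupD[OF B] mult_carrier_mat[of _ m m _ m]
    left_mult_one_mat[of _ m m] right_mult_one_mat[of _ m m]
  have comm: "commutator (unitary_group m) A B = A * B * (mat_adjoint A * mat_adjoint B)"
    by (simp add: commutator_def inv_unitary_group A B)
      (simp add: unitary_group_def, intro assoc_mult_mat[of _ m m _ m _ m], simp_all)
  have inv: "mat_adjoint A * mat_adjoint B * (B * A) = 1\<^sub>m m"
    "B * A * (mat_adjoint A * mat_adjoint B) = 1\<^sub>m m"
    using unitary_groupD[OF unitary_group_mult[OF B A]] by (simp_all add: mat_adjoint_mult[of _ m m _ m])
  show ?thesis
  proof
    assume "commutator (unitary_group m) A B = z \<cdot>\<^sub>m 1\<^sub>m m"
    then have "A * B * (mat_adjoint A * mat_adjoint B) * (B * A) = z \<cdot>\<^sub>m 1\<^sub>m m * (B * A)"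
      by (simp add: comm)
    moreover have "A * B * (mat_adjoint A * mat_adjoint B) * (B * A)
        = A * B * (mat_adjoint A * mat_adjoint B * (B * A))"
      by (rule assoc_mult_mat[of _ m m _ m _ m]) auto
    ultimately show "A * B = z \<cdot>\<^sub>m (B * A)"
      by (simp add: inv mult_smult_assoc_mat[of _ m m _ m] right_mult_one_mat[of _ m m])
  next
    assume "A * B = z \<cdot>\<^sub>m (B * A)"
    then show "commutator (unitary_group m) A B = z \<cdot>\<^sub>m 1\<^sub>m m"
      by (simp add: comm inv mult_smult_assoc_mat[of _ m m _ m])
  qed
qed

lemma cscalar_prod_unitary:
  assumes "A \<in> carrier (unitary_group m)" "u \<in> carrier_vec m" "w \<in> carrier_vec m"
  shows "(A *\<^sub>v u) \<bullet>c (A *\<^sub>v w) = u \<bullet>c w"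
proof -
  note A = unitary_groupD[OF assms(1)]
  have "(A *\<^sub>v u) \<bullet>c (A *\<^sub>v w) = u \<bullet>c (mat_adjoint A *\<^sub>v (A *\<^sub>v w))"
    using A assms by (intro cscalar_prod_mult_mat_vec[of _ m m]) auto
  also have "mat_adjoint A *\<^sub>v (A *\<^sub>v w) = (mat_adjoint A * A) *\<^sub>v w"
    using A(1) assms by (simp add: assoc_mult_mat_vec[of _ m m _ m])
  finally show ?thesis using A assms by simp
qed

lemma cscalar_prod_smult:
  fixes u w :: "complex vec"
  assumes "u \<in> carrier_vec m" "w \<in> carrier_vec m"
  shows "(a \<cdot>\<^sub>v u) \<bullet>c (b \<cdot>\<^sub>v w) = a * cnj b * (u \<bullet>c w)"
  using assms by (simp add: conjugate_smult_vec)

lemma cscalar_prod_commute: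
  fixes u w :: "complex vec"
  assumes "u \<in> carrier_vec m" "w \<in> carrier_vec m"
  shows "u \<bullet>c w = cnj (w \<bullet>c u)"
  using assms by (metis conjugate_conjugate_sprod conjugate_vec_sprod_comm conjugate_complex_def)

lemma unitary_eigenvalue_norm:
  assumes A: "A \<in> carrier (unitary_group m)" and v: "v \<in> carrier_vec m" "v \<noteq> 0\<^sub>v m"
    and eig: "A *\<^sub>v v = c \<cdot>\<^sub>v v"
  shows "cmod c = 1"
proof -
  have "c * cnj c * (v \<bullet>c v) = 1 * (v \<bullet>c v)"
    using cscalar_prod_unitary[OF A v(1) v(1)] cscalar_prod_smult[OF v(1) v(1), of c c] eig
    by simp
  moreover have "v \<bullet>c v \<noteq> 0"
    using v conjugate_square_eq_0_vec by blast
  ultimately have "c * cnj c = 1"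
    by (rule mult_right_cancel[THEN iffD1, rotated])
  then have "(cmod c)\<^sup>2 = 1"
    by (metis complex_norm_square of_real_eq_1_iff)
  then show ?thesis
    using norm_ge_zero[of c] unfolding power2_eq_1_iff by linarith
qed

section \<open>Common eigenvectors in invariant subspaces\<close>

definition invariant_under :: "'a :: semiring_0 mat \<Rightarrow> 'a vec set \<Rightarrow> bool" where
  "invariant_under A S \<longleftrightarrow> (\<forall>v\<in>S. A *\<^sub>v v \<in> S)"

definition vec_subspace :: "nat \<Rightarrow> 'a :: field vec set \<Rightarrow> bool" where
  "vec_subspace m S \<longleftrightarrow> S \<subseteq> carrier_vec m \<and> 0\<^sub>v m \<in> S \<and>
     (\<forall>u\<in>S. \<forall>v\<in>S. u + v \<in> S) \<and> (\<forall>c. \<forall>v\<in>S. c \<cdot>\<^sub>v v \<in> S)"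

lemma mult_mat_vec_zero: "A \<in> carrier_mat n m \<Longrightarrow> A *\<^sub>v 0\<^sub>v m = 0\<^sub>v n"
  by (intro eq_vecI) auto

text \<open>Horner evaluation of the vector \<open>p(A) v\<close>.\<close>

definition poly_mat_vec :: "'a :: field mat \<Rightarrow> 'a vec \<Rightarrow> 'a poly \<Rightarrow> 'a vec" where
  "poly_mat_vec A v p = fold_coeffs (\<lambda>a w. a \<cdot>\<^sub>v v + A *\<^sub>v w) p (0\<^sub>v (dim_vec v))"

context
  fixes m :: nat and A :: "'a :: field mat" and v :: "'a vec"
  assumes A: "A \<in> carrier_mat m m" and v: "v \<in> carrier_vec m"
begin

lemma poly_mat_vec_0 [simp]: "poly_mat_vec A v 0 = 0\<^sub>v m"
  using v by (simp add: poly_mat_vec_def)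

lemma poly_mat_vec_pCons:
  "poly_mat_vec A v (pCons a p) = a \<cdot>\<^sub>v v + A *\<^sub>v poly_mat_vec A v p"
proof (cases "p = 0 \<and> a = 0")
  \<comment> \<open>\<open>pCons 0 0\<close> is the zero polynomial, on which
    \<open>fold_coeffs\<close> performs no step; here both sides are the zero vector.\<close>
  case True
  moreover have "A *\<^sub>v 0\<^sub>v m = 0\<^sub>v m" using A by (intro eq_vecI) auto
  ultimately show ?thesis using v by (intro eq_vecI) auto
next
  case False
  then show ?thesis by (auto simp: poly_mat_vec_def)
qed

lemma poly_mat_vec_carrier [simp]: "poly_mat_vec A v p \<in> carrier_vec m"
  by (induction p) (use A v in \<open>auto simp: poly_mat_vec_pCons\<close>)

lemma dim_poly_mat_vec [simp]: "dim_vec (poly_mat_vec A v p) = m"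
  by (rule carrier_vecD) simp

lemma poly_mat_vec_smult: "poly_mat_vec A v (smult c p) = c \<cdot>\<^sub>v poly_mat_vec A v p"
proof (induction p)
  case 0
  then show ?case by auto
next
  case (pCons a p)
  then show ?case
    using A v
    by (simp add: poly_mat_vec_pCons smult_add_distrib_vec[of _ m] smult_smult_assoc
        mult_mat_vec[of _ m m])
qed

lemma poly_mat_vec_add:
  "poly_mat_vec A v (p + q) = poly_mat_vec A v p + poly_mat_vec A v q"
proof (induction p q rule: poly_induct2)
  case 0
  then show ?case by auto
next
  case (pCons a p b q)
  then show ?case
    using A v
    by (intro eq_vecI)
      (simp_all add: poly_mat_vec_pCons add_smult_distrib_vec mult_add_distrib_mat_vec[of _ m m]
        algebra_simps)
qed

text \<open>Makes roots of an annihilating polynomial into eigenvalues: if the left side is zero and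
  q(A) v is not, then q(A) v is an eigenvector for \<open>c\<close>.\<close>

lemma poly_mat_vec_linear_factor:
  "poly_mat_vec A v ([:-c, 1:] * q) = A *\<^sub>v poly_mat_vec A v q + (-c) \<cdot>\<^sub>v poly_mat_vec A v q"
proof -
  have "[:-c, 1:] * q = pCons 0 q + smult (-c) q" by simp
  then show ?thesis
    using A v
    by (simp only: poly_mat_vec_add poly_mat_vec_pCons poly_mat_vec_smult) (intro eq_vecI, auto)
qed

lemma poly_mat_vec_in:
  assumes "vec_subspace m S" "invariant_under A S" "v \<in> S"
  shows "poly_mat_vec A v p \<in> S"
  using assms
  by (induction p) (auto simp: poly_mat_vec_pCons vec_subspace_def invariant_under_def)

text \<open>The \<open>m + 1\<close> vectors \<open>v, A v, \<dots>, A^m v\<close> are linearly dependent; the square matrix below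
  has them as columns, on top of a zero row.\<close>

lemma annihilating_poly:
  "\<exists>p. p \<noteq> 0 \<and> poly_mat_vec A v p = 0\<^sub>v m"
proof -
  define K where "K = mat (Suc m) (Suc m)
    (\<lambda>(i, j). if i < m then poly_mat_vec A v (monom 1 j) $ i else 0)"
  have K: "K \<in> carrier_mat (Suc m) (Suc m)" by (simp add: K_def)
  have "det K = 0"
  proof -
    have "det K = (\<Sum>j<Suc m. K $$ (m, j) * cofactor K m j)"
      using laplace_expansion_row[OF K] by simp
    also have "\<dots> = 0" by (intro sum.neutral) (simp add: K_def)
    finally show ?thesis .
  qed
  then obtain c where c: "c \<in> carrier_vec (Suc m)" "c \<noteq> 0\<^sub>v (Suc m)"
    and Kc: "K *\<^sub>v c = 0\<^sub>v (Suc m)"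
    using det_0_iff_vec_prod_zero_field[OF K] by auto
  define p where "p = (\<Sum>j<Suc m. monom (c $ j) j)"
  have coeff_p: "coeff p j = (if j < Suc m then c $ j else 0)" for j
    by (auto simp: p_def coeff_sum)
  have "p \<noteq> 0"
  proof
    assume "p = 0"
    then have "c $ j = 0" if "j < Suc m" for j
      using coeff_p[of j] that by simp
    then have "c = 0\<^sub>v (Suc m)" using c by (intro eq_vecI) auto
    then show False using c by simp
  qed
  moreover have "poly_mat_vec A v p = 0\<^sub>v m"
  proof (rule eq_vecI)
    fix i assume i: "i < dim_vec (0\<^sub>v m :: 'a vec)"
    have *: "poly_mat_vec A v (\<Sum>j\<in>J. monom (c $ j) j) $ i
        = (\<Sum>j\<in>J. poly_mat_vec A v (monom 1 j) $ i * c $ j)" if "finite J" for J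
      using that
    proof (induction J)
      case empty
      then show ?case using i by simp
    next
      case (insert j J)
      have "monom (c $ j) j = smult (c $ j) (monom 1 j)" by (simp add: smult_monom)
      then have "poly_mat_vec A v (monom (c $ j) j) $ i = poly_mat_vec A v (monom 1 j) $ i * c $ j"
        using i by (simp add: poly_mat_vec_smult)
      then show ?case
        using insert i by (simp add: poly_mat_vec_add)
    qed
    have "(K *\<^sub>v c) $ i = (\<Sum>j<Suc m. poly_mat_vec A v (monom 1 j) $ i * c $ j)"
      using K c i by (simp add: scalar_prod_def K_def atLeast0LessThan del: sum.lessThan_Suc)
    then show "poly_mat_vec A v p $ i = 0\<^sub>v m $ i"
      using Kc i by (simp add: * p_def del: sum.lessThan_Suc)
  qed simp
  ultimately show ?thesis by blast
qed

end

text \<open>Take a nonzero polynomial that annihilates \<open>v\<close> and split off linear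
  factors. At some point a factor kills a nonzero vector q(A) v, which lies in \<open>S\<close> by
  invariance; otherwise a nonzero constant would annihilate \<open>v\<close>.\<close>

lemma eigenvector_in_subspace:
  fixes A :: "complex mat"
  assumes A: "A \<in> carrier_mat m m" and S: "vec_subspace m S" "invariant_under A S"
    and v: "v \<in> S" "v \<noteq> 0\<^sub>v m"
  shows "\<exists>w c. w \<in> S \<and> w \<noteq> 0\<^sub>v m \<and> A *\<^sub>v w = c \<cdot>\<^sub>v w"
proof -
  have vm: "v \<in> carrier_vec m" using S v by (auto simp: vec_subspace_def)
  have "\<exists>w c. w \<in> S \<and> w \<noteq> 0\<^sub>v m \<and> A *\<^sub>v w = c \<cdot>\<^sub>v w"
    if "p \<noteq> 0" "poly_mat_vec A v p = 0\<^sub>v m" for p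
    using that
  proof (induction "degree p" arbitrary: p rule: less_induct)
    case less
    show ?case
    proof (cases "degree p = 0")
      case True
      then obtain a where p: "p = [:a:]" by (rule degree_eq_zeroE)
      have "a \<cdot>\<^sub>v v = 0\<^sub>v m"
        using less(3) A vm mult_mat_vec_zero[OF A]
        by (simp add: p poly_mat_vec_pCons[OF A vm] poly_mat_vec_0[OF A vm])
      then have "v = 0\<^sub>v m"
        using less(2) p vm by (intro eq_vecI) (auto simp: vec_eq_iff)
      then show ?thesis using v by simp
    next
      case False
      then obtain c where "poly p c = 0"
        using fundamental_theorem_of_algebra[of p] constant_degree[of p] by auto
      then obtain q where p: "p = [:-c, 1:] * q"
        by (auto simp: poly_eq_0_iff_dvd)
      define w where "w = poly_mat_vec A v q"
      have w: "w \<in> carrier_vec m" "w \<in> S"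
        using poly_mat_vec_in[OF A vm S v(1)] S by (auto simp: w_def vec_subspace_def)
      have q: "q \<noteq> 0" using p less(2) by auto
      have "degree p = degree [:-c, 1:] + degree q"
        unfolding p by (rule degree_mult_eq) (use q in auto)
      then have deg: "degree q < degree p" by simp
      \<comment> \<open>Either \<open>q\<close> annihilates \<open>v\<close> too and has smaller
        degree, or \<open>w\<close> is an eigenvector for the root \<open>c\<close>.\<close>
      show ?thesis
      proof (cases "w = 0\<^sub>v m")
        case True
        then show ?thesis using less(1)[OF deg q] by (simp add: w_def)
      next
        case False
        have eq: "A *\<^sub>v w + (-c) \<cdot>\<^sub>v w = 0\<^sub>v m"
          using less(3) unfolding p poly_mat_vec_linear_factor[OF A vm] w_def .
        have "A *\<^sub>v w = c \<cdot>\<^sub>v w"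
        proof (rule eq_vecI)
          fix i assume "i < dim_vec (c \<cdot>\<^sub>v w)"
          then show "(A *\<^sub>v w) $ i = (c \<cdot>\<^sub>v w) $ i"
            using arg_cong[OF eq, of "\<lambda>x. x $ i"] A w by simp
        qed (use A w in auto)
        then show ?thesis using False w by blast
      qed
    qed
  qed
  then show ?thesis using annihilating_poly[OF A vm] by blast
qed

text \<open>The eigenspace of the first matrix within \<open>S\<close> is again a nonzero subspace,
  and the remaining matrices preserve it because they commute with the first. The induction
  therefore has to let \<open>S\<close> vary.\<close>

lemma common_eigenvector_in_subspace:
  fixes \<A> :: "complex mat list"
  assumes "set \<A> \<subseteq> carrier_mat m m"
    and "\<And>A B. A \<in> set \<A> \<Longrightarrow> B \<in> set \<A> \<Longrightarrow> A * B = B * A"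
    and "vec_subspace m S" "\<And>A. A \<in> set \<A> \<Longrightarrow> invariant_under A S"
    and "v \<in> S" "v \<noteq> 0\<^sub>v m"
  shows "\<exists>w\<in>S. w \<noteq> 0\<^sub>v m \<and> (\<forall>A\<in>set \<A>. \<exists>c. A *\<^sub>v w = c \<cdot>\<^sub>v w)"
  using assms
proof (induction \<A> arbitrary: S v)
  case Nil
  then show ?case by auto
next
  case (Cons A \<A>)
  have A: "A \<in> carrier_mat m m" using Cons.prems by simp
  obtain w c where w: "w \<in> S" "w \<noteq> 0\<^sub>v m" "A *\<^sub>v w = c \<cdot>\<^sub>v w"
    using eigenvector_in_subspace[OF A Cons.prems(3) Cons.prems(4) Cons.prems(5,6)] by auto
  define T where "T = {u \<in> S. A *\<^sub>v u = c \<cdot>\<^sub>v u}"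
  have S: "S \<subseteq> carrier_vec m" using Cons.prems by (simp add: vec_subspace_def)
  have "A *\<^sub>v (u + u') = c \<cdot>\<^sub>v (u + u')"
    if "u \<in> T" "u' \<in> T" for u u'
    using that S A mult_add_distrib_mat_vec[of A m m u u'] smult_add_distrib_vec[of u m u' c]
    by (auto simp: T_def subset_eq)
  moreover have "A *\<^sub>v (b \<cdot>\<^sub>v u) = c \<cdot>\<^sub>v (b \<cdot>\<^sub>v u)" if "u \<in> T" for b u
    using that S A mult_mat_vec[of A m m u b]
    by (auto simp: T_def subset_eq smult_smult_assoc mult.commute)
  moreover have "A *\<^sub>v 0\<^sub>v m = c \<cdot>\<^sub>v 0\<^sub>v m"
    using A by (intro eq_vecI) auto
  ultimately have T: "vec_subspace m T"
    using Cons.prems(3) by (auto simp: vec_subspace_def T_def)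
  have inv: "invariant_under B T" if B: "B \<in> set \<A>" for B
    unfolding invariant_under_def
  proof
    fix u assume u: "u \<in> T"
    then have u': "u \<in> S" "u \<in> carrier_vec m" "A *\<^sub>v u = c \<cdot>\<^sub>v u" using S by (auto simp: T_def)
    have Bm: "B \<in> carrier_mat m m" and comm: "A * B = B * A" using Cons.prems(1,2) B by auto
    have "A *\<^sub>v (B *\<^sub>v u) = B *\<^sub>v (A *\<^sub>v u)"
      using A Bm comm u' by (metis assoc_mult_mat_vec)
    then have "A *\<^sub>v (B *\<^sub>v u) = c \<cdot>\<^sub>v (B *\<^sub>v u)"
      using u' Bm by (simp add: mult_mat_vec[of B m m u c])
    moreover have "B *\<^sub>v u \<in> S"
      using Cons.prems(4)[of B] B u' by (auto simp: invariant_under_def)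
    ultimately show "B *\<^sub>v u \<in> T" by (simp add: T_def)
  qed
  have "w \<in> T" using w by (simp add: T_def)
  then obtain x where x: "x \<in> T" "x \<noteq> 0\<^sub>v m" "\<forall>A\<in>set \<A>. \<exists>c. A *\<^sub>v x = c \<cdot>\<^sub>v x"
    using Cons.IH[OF _ _ T inv _ w(2)] Cons.prems(1,2) by auto
  then show ?case by (auto simp: T_def)
qed

section \<open>Orthonormal sets and dimension\<close>

lemma orthonormal_lin_indpt:
  assumes S: "orthonormal S" "S \<subseteq> carrier_vec m" and finS: "finite S"
  shows "module.lin_indpt class_ring (module_vec TYPE(complex) m) S"
proof -
  interpret vec_space "TYPE(complex)" m .
  have "a w = 0" if a: "lincomb a S = 0\<^sub>v m" and w: "w \<in> S" for a w
  proof -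
    have "0 = finsum V (\<lambda>v. a v \<cdot>\<^sub>v v) S \<bullet>c w"
      using a w S by (auto simp: lincomb_def)
    also have "\<dots> = (\<Sum>v\<in>S. (a v \<cdot>\<^sub>v v) \<bullet>c w)"
      using w S by (intro finsum_scalar_prod_sum) auto
    also have "\<dots> = (\<Sum>v\<in>S. if v = w then a w else 0)"
    proof (rule sum.cong)
      fix v assume "v \<in> S"
      then have "v \<in> carrier_vec m" "w \<in> carrier_vec m" "v \<bullet>c w = (if v = w then 1 else 0)"
        using w S by (auto simp: orthonormal_def)
      then show "(a v \<cdot>\<^sub>v v) \<bullet>c w = (if v = w then a w else 0)" by auto
    qed simp
    also have "\<dots> = a w" using finS w by simp
    finally show ?thesis by simp
  qed
  then show ?thesis using S finS by (intro finite_lin_indpt2) auto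
qed

lemma orthonormal_card_le:
  assumes "orthonormal S" "S \<subseteq> carrier_vec m" "finite S"
  shows "card S \<le> m"
proof -
  interpret vec_space "TYPE(complex)" m .
  show ?thesis
    using li_le_dim(2)[OF fin_dim _ orthonormal_lin_indpt[OF assms]] assms by (simp add: dim_is_n)
qed

lemma orthonormal_basisI:
  assumes "orthonormal S" "S \<subseteq> carrier_vec m" "finite S" "card S = m"
  shows "orthonormal_basis m S"
proof -
  interpret vec_space "TYPE(complex)" m .
  show ?thesis
    using dim_li_is_basis[OF fin_dim _ _ orthonormal_lin_indpt[OF assms(1-3)]] assms
    by (simp add: dim_is_n orthonormal_basis_def)
qed

text \<open>Orthogonality to \<open>S\<close> is a homogeneous linear system with fewer than
  \<open>m\<close> equations. Padding it with zero rows gives a singular square matrix.\<close>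

lemma exists_orthogonal_vec:
  fixes S :: "complex vec set"
  assumes S: "S \<subseteq> carrier_vec m" "finite S" "card S < m"
  shows "\<exists>u\<in>carrier_vec m. u \<noteq> 0\<^sub>v m \<and> (\<forall>w\<in>S. u \<bullet>c w = 0)"
proof -
  obtain xs where xs: "set xs = S" "length xs = card S"
    using finite_distinct_list[OF S(2)] distinct_card by metis
  define K where "K = mat m m (\<lambda>(i, j). if i < length xs then cnj (xs ! i $ j) else 0)"
  have K: "K \<in> carrier_mat m m" by (simp add: K_def)
  \<comment> \<open>Row \<open>m - 1\<close> is one of the padding rows, since
    \<open>card S < m\<close>.\<close>
  have "det K = (\<Sum>j<m. K $$ (m - 1, j) * cofactor K (m - 1) j)"
    using S by (intro laplace_expansion_row[OF K]) simp
  also have "\<dots> = 0"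
    using S xs by (intro sum.neutral) (auto simp: K_def)
  finally obtain u where u: "u \<in> carrier_vec m" "u \<noteq> 0\<^sub>v m" and Ku: "K *\<^sub>v u = 0\<^sub>v m"
    using det_0_iff_vec_prod_zero_field[OF K] by auto
  have "u \<bullet>c w = 0" if w: "w \<in> S" for w
  proof -
    obtain i where i: "i < length xs" "w = xs ! i"
      using w xs by (metis in_set_conv_nth)
    have "u \<bullet>c w = (K *\<^sub>v u) $ i"
      using i u w xs S by (auto simp: scalar_prod_def K_def mult.commute intro!: sum.cong)
    then show ?thesis using i xs S Ku by simp
  qed
  then show ?thesis using u by blast
qed

section \<open>Matrices commuting up to a scalar\<close>

lemma smult_smult_mat: "a \<cdot>\<^sub>m (b \<cdot>\<^sub>m A) = (a * b :: 'a :: semigroup_mult) \<cdot>\<^sub>m A"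
  by (intro eq_matI) (auto simp: mult.assoc)

lemma one_smult_mat: "(1 :: 'a :: monoid_mult) \<cdot>\<^sub>m A = A"
  by (intro eq_matI) auto

lemma smult_mat_mult_vec: "(a \<cdot>\<^sub>m A) *\<^sub>v v = (a :: 'a :: semiring_0) \<cdot>\<^sub>v (A *\<^sub>v v)"
  if "dim_vec v = dim_col A"
  using that by (intro eq_vecI) (auto simp: scalar_prod_def sum_distrib_left mult.assoc)

lemma scalar_commute_mult:
  fixes A\<^sub>1 A\<^sub>2 B :: "'a :: comm_ring_1 mat"
  assumes carrier: "A\<^sub>1 \<in> carrier_mat m m" "A\<^sub>2 \<in> carrier_mat m m" "B \<in> carrier_mat m m"
    and eq: "B * A\<^sub>1 = z\<^sub>1 \<cdot>\<^sub>m (A\<^sub>1 * B)" "B * A\<^sub>2 = z\<^sub>2 \<cdot>\<^sub>m (A\<^sub>2 * B)"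
  shows "B * (A\<^sub>1 * A\<^sub>2) = (z\<^sub>1 * z\<^sub>2) \<cdot>\<^sub>m (A\<^sub>1 * A\<^sub>2 * B)"
proof -
  have "B * (A\<^sub>1 * A\<^sub>2) = B * A\<^sub>1 * A\<^sub>2"
    using carrier by (simp add: assoc_mult_mat[of _ m m _ m _ m])
  also have "\<dots> = z\<^sub>1 \<cdot>\<^sub>m (A\<^sub>1 * B * A\<^sub>2)"
    using carrier eq(1) by (simp add: mult_smult_assoc_mat[of _ m m _ m])
  also have "A\<^sub>1 * B * A\<^sub>2 = A\<^sub>1 * (B * A\<^sub>2)"
    using carrier by (simp add: assoc_mult_mat[of _ m m _ m _ m])
  also have "\<dots> = z\<^sub>2 \<cdot>\<^sub>m (A\<^sub>1 * (A\<^sub>2 * B))"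
    using carrier eq(2) by (simp add: mult_smult_distrib[of _ m m _ m])
  also have "A\<^sub>1 * (A\<^sub>2 * B) = A\<^sub>1 * A\<^sub>2 * B"
    using carrier by (simp add: assoc_mult_mat[of _ m m _ m _ m])
  finally show ?thesis
    by (simp add: smult_smult_mat)
qed

lemma scalar_commute_pow:
  fixes A B :: "'a :: comm_ring_1 mat"
  assumes "A \<in> carrier_mat m m" "B \<in> carrier_mat m m" "B * A = z \<cdot>\<^sub>m (A * B)"
  shows "B * A ^\<^sub>m k = z ^ k \<cdot>\<^sub>m (A ^\<^sub>m k * B)"
proof (induction k)
  case 0
  then show ?case using assms by (auto intro!: eq_matI)
next
  case (Suc k)
  then show ?case
    using scalar_commute_mult[of "A ^\<^sub>m k" m A B "z ^ k" z] assms by (simp add: mult.commute)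
qed

lemma commute_pow:
  fixes A B :: "'a :: comm_ring_1 mat"
  assumes "A \<in> carrier_mat m m" "B \<in> carrier_mat m m" "B * A = A * B"
  shows "B * A ^\<^sub>m k = A ^\<^sub>m k * B"
  using scalar_commute_pow[of A m B 1 k] assms by (simp add: one_smult_mat)

lemma pow_mat_Suc_left:
  fixes A :: "'a :: comm_ring_1 mat"
  assumes "A \<in> carrier_mat m m"
  shows "A ^\<^sub>m Suc k = A * A ^\<^sub>m k"
  using commute_pow[OF assms assms] by simp

text \<open>Generalises \<open>power_product\<close> from \<open>[1..<Suc t]\<close> to any index
  list, so that facts about it can be proved by induction on the list.\<close>

definition power_prod_list :: "nat \<Rightarrow> (nat \<Rightarrow> complex mat) \<Rightarrow> nat list \<Rightarrow> (nat \<Rightarrow> nat) \<Rightarrow> complex mat"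
  where "power_prod_list m A xs p = foldr (\<lambda>i M. (A i ^\<^sub>m p i) * M) xs (1\<^sub>m m)"

lemma power_prod_list_simps [simp]:
  "power_prod_list m A [] p = 1\<^sub>m m"
  "power_prod_list m A (x # xs) p = A x ^\<^sub>m p x * power_prod_list m A xs p"
  by (simp_all add: power_prod_list_def)

lemma power_prod_list_carrier:
  assumes "\<And>i. i \<in> set xs \<Longrightarrow> A i \<in> carrier_mat m m"
  shows "power_prod_list m A xs p \<in> carrier_mat m m"
  using assms by (induction xs) (auto intro!: mult_carrier_mat[of _ m m _ m])

lemma power_prod_list_unitary:
  assumes "\<And>i. i \<in> set xs \<Longrightarrow> A i \<in> carrier (unitary_group m)"
  shows "power_prod_list m A xs p \<in> carrier (unitary_group m)"
  using assms by (induction xs) (auto intro!: unitary_group_mult unitary_group_pow unitary_group_one)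

lemma power_prod_list_scalar_commute:
  assumes "\<And>i. i \<in> set xs \<Longrightarrow> A i \<in> carrier_mat m m" "B \<in> carrier_mat m m"
    and "\<And>i. i \<in> set xs \<Longrightarrow> B * A i = z i \<cdot>\<^sub>m (A i * B)" "distinct xs"
  shows "B * power_prod_list m A xs p
    = (\<Prod>i\<in>set xs. z i ^ p i) \<cdot>\<^sub>m (power_prod_list m A xs p * B)"
  using assms
proof (induction xs)
  case Nil
  then show ?case by (auto intro!: eq_matI)
next
  case (Cons x xs)
  have "B * A x ^\<^sub>m p x = z x ^ p x \<cdot>\<^sub>m (A x ^\<^sub>m p x * B)"
    using Cons.prems by (intro scalar_commute_pow[of _ m]) auto
  then show ?case
    using Cons by (auto intro!: scalar_commute_mult[of _ m] power_prod_list_carrier)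
qed

text \<open>\<open>A i\<close> moves past the factors in front until it meets its own power, whose
  exponent it raises by one.\<close>

lemma mult_power_prod_list:
  assumes "\<And>j. j \<in> set xs \<Longrightarrow> A j \<in> carrier_mat m m"
    and "\<And>j. j \<in> set xs \<Longrightarrow> A i * A j = A j * A i" "distinct xs" "i \<in> set xs"
  shows "A i * power_prod_list m A xs p = power_prod_list m A xs (p(i := Suc (p i)))"
  using assms
proof (induction xs)
  case (Cons x xs)
  have carrier: "A i \<in> carrier_mat m m" "A x \<in> carrier_mat m m"
      "power_prod_list m A xs p \<in> carrier_mat m m"
    using Cons.prems by (auto intro!: power_prod_list_carrier)
  have assoc: "A i * (A x ^\<^sub>m p x * power_prod_list m A xs p)
      = A i * A x ^\<^sub>m p x * power_prod_list m A xs p"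
    using carrier by (intro assoc_mult_mat[symmetric, of _ m m _ m _ m]) auto
  show ?case
  proof (cases "x = i")
    case True
    \<comment> \<open>The list is distinct, so the tail has no factor with index \<open>i\<close>
      and does not see the changed exponent.\<close>
    then have "power_prod_list m A xs (p(i := Suc (p i))) = power_prod_list m A xs p"
      using Cons.prems(3) unfolding power_prod_list_def by (intro foldr_cong) auto
    then show ?thesis
      using True assoc pow_mat_Suc_left[OF carrier(1), of "p i"]
      by (simp add: fun_upd_same del: fun_upd_apply pow_mat.simps)
  next
    case False
    then have IH: "A i * power_prod_list m A xs p = power_prod_list m A xs (p(i := Suc (p i)))"
      using Cons.prems by (intro Cons.IH) auto
    have "A i * A x ^\<^sub>m p x = A x ^\<^sub>m p x * A i"
      using carrier Cons.prems(2)[of x] by (intro commute_pow[of _ m]) auto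
    then have "A i * (A x ^\<^sub>m p x * power_prod_list m A xs p)
        = A x ^\<^sub>m p x * (A i * power_prod_list m A xs p)"
      using carrier assoc by (simp add: assoc_mult_mat[of _ m m _ m _ m])
    then show ?thesis using False IH by (simp del: fun_upd_apply add: fun_upd_other)
  qed
qed simp

section \<open>Invariance of orthogonal complements\<close>

lemma vec_subspace_orthogonal:
  fixes F :: "complex vec set"
  assumes "F \<subseteq> carrier_vec m"
  shows "vec_subspace m {u \<in> carrier_vec m. \<forall>w\<in>F. u \<bullet>c w = 0}"
  using assms
  by (auto simp: vec_subspace_def subset_eq add_scalar_prod_distrib[of _ m])

text \<open>A unitary \<open>B\<close> preserves inner products, so the product of
  \<open>B u\<close> with \<open>B w'\<close> is that of \<open>u\<close> with \<open>w'\<close>. It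
  thus suffices that every member of \<open>F\<close> is hit by \<open>B\<close> from within
  \<open>F\<close> up to a scalar.\<close>

lemma invariant_under_orthogonal:
  assumes B: "B \<in> carrier (unitary_group m)" and F: "F \<subseteq> carrier_vec m"
    and perm: "\<And>w. w \<in> F \<Longrightarrow> \<exists>c w'. w' \<in> F \<and> w = c \<cdot>\<^sub>v (B *\<^sub>v w')"
  shows "invariant_under B {u \<in> carrier_vec m. \<forall>w\<in>F. u \<bullet>c w = 0}"
  unfolding invariant_under_def
proof safe
  fix u :: "complex vec" assume u: "u \<in> carrier_vec m" "\<forall>w\<in>F. u \<bullet>c w = 0"
  note Bm = unitary_groupD(1)[OF B]
  show "B *\<^sub>v u \<in> carrier_vec m" using Bm u by simp
  fix w assume "w \<in> F"
  then obtain c w' where w': "w' \<in> F" "w = c \<cdot>\<^sub>v (B *\<^sub>v w')"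
    using perm by blast
  then have w'm: "w' \<in> carrier_vec m" using F by auto
  have "(B *\<^sub>v u) \<bullet>c w = cnj c * ((B *\<^sub>v u) \<bullet>c (B *\<^sub>v w'))"
    using cscalar_prod_smult[of "B *\<^sub>v u" m "B *\<^sub>v w'" 1 c] Bm u w'm w'(2) by simp
  then show "(B *\<^sub>v u) \<bullet>c w = 0"
    using cscalar_prod_unitary[OF B u(1) w'm] u w' by simp
qed

lemma invariant_under_pow:
  assumes "A \<in> carrier_mat m m" "S \<subseteq> carrier_vec m" "invariant_under A S"
  shows "invariant_under (A ^\<^sub>m k) S"
proof (induction k)
  case 0
  then show ?case using assms by (auto simp: invariant_under_def subset_eq)
next
  case (Suc k)
  then show ?case
    using assms by (auto simp: invariant_under_def subset_eq assoc_mult_mat_vec[of _ m m _ m])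
qed

lemma invariant_under_power_prod_list:
  assumes "\<And>i. i \<in> set xs \<Longrightarrow> A i \<in> carrier_mat m m" "S \<subseteq> carrier_vec m"
    and "\<And>i. i \<in> set xs \<Longrightarrow> invariant_under (A i) S"
  shows "invariant_under (power_prod_list m A xs p) S"
  using assms
proof (induction xs)
  case Nil
  then show ?case by (auto simp: invariant_under_def subset_eq)
next
  case (Cons x xs)
  have "invariant_under (A x ^\<^sub>m p x) S"
    using Cons.prems by (intro invariant_under_pow[of _ m]) auto
  moreover have "power_prod_list m A xs p \<in> carrier_mat m m"
    using Cons.prems by (intro power_prod_list_carrier) auto
  ultimately show ?case
    using Cons by (auto simp: invariant_under_def subset_eq assoc_mult_mat_vec[of _ m m _ m])
qed

section \<open>Translates of a common eigenvector\<close>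

locale almost_commuting =
  fixes n m t :: nat and d :: "nat \<Rightarrow> rat_mod_int" and A :: "nat \<Rightarrow> complex mat"
  assumes le: "2 * t \<le> n"
    and A: "A \<in> almost_commuting_tuples n m (D_matrix t d)"
begin

abbreviation "q i \<equiv> qz_order (d i)"
abbreviation "translate p v \<equiv> power_product m A t p *\<^sub>v v"

text \<open>Exponents outside \<open>{1..t}\<close> are left free, as in the theorem; counting is
  done with \<open>exponents\<close> instead.\<close>

definition admissible :: "(nat \<Rightarrow> nat) set" where
  "admissible = {p. \<forall>i\<in>{1..t}. p i < q i}"

lemma power_product_eq: "power_product m A t = power_prod_list m A [1..<Suc t]"
  by (simp add: fun_eq_iff power_product_def power_prod_list_def)

lemma unitary: "i \<in> {1..n} \<Longrightarrow> A i \<in> carrier (unitary_group m)"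
  using A by (auto simp: almost_commuting_tuples_def)

lemma carrier: "i \<in> {1..n} \<Longrightarrow> A i \<in> carrier_mat m m"
  using unitary unitary_groupD by blast

lemma scalar_commute:
  "i \<in> {1..n} \<Longrightarrow> j \<in> {1..n} \<Longrightarrow> A i * A j = exp_2pi_i (D_matrix t d i j) \<cdot>\<^sub>m (A j * A i)"
  using A unitary[of i] unitary[of j]
  by (subst commutator_eq_scalar_iff[symmetric, of _ m]) (auto simp: almost_commuting_tuples_def)

lemma commute:
  "i \<in> {1..n} \<Longrightarrow> j \<in> {1..n} \<Longrightarrow> D_matrix t d i j = 0 \<Longrightarrow> A i * A j = A j * A i"
  by (metis scalar_commute exp_2pi_i_0 one_smult_mat)

lemma commute_first:
  "i \<in> {1..t} \<Longrightarrow> j \<in> {1..t} \<Longrightarrow> A i * A j = A j * A i"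
  using le by (intro commute) (auto simp: D_matrix_def)

lemma scalar_commute_dual:
  assumes k: "k \<in> {1..t}" and i: "i \<in> {1..t}"
  shows "A (k + t) * A i = (if i = k then exp_2pi_i (d k) else 1) \<cdot>\<^sub>m (A i * A (k + t))"
  using scalar_commute[of "k + t" i] k i le by (auto simp: D_matrix_def)

lemma power_product_unitary: "power_product m A t p \<in> carrier (unitary_group m)"
  unfolding power_product_eq using le by (intro power_prod_list_unitary unitary) auto

lemma power_product_carrier: "power_product m A t p \<in> carrier_mat m m"
  using power_product_unitary unitary_groupD by blast

lemma translate_carrier [simp]: "v \<in> carrier_vec m \<Longrightarrow> translate p v \<in> carrier_vec m"
  using power_product_carrier by (rule mult_mat_vec_carrier)

text \<open>Among \<open>A 1\<close>, ..., \<open>A t\<close> only \<open>A k\<close> picks up a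
  scalar when \<open>A (k + t)\<close> passes it, and it occurs \<open>p k\<close> times.\<close>

lemma dual_power_product:
  assumes "k \<in> {1..t}"
  shows "A (k + t) * power_product m A t p
    = exp_2pi_i (d k) ^ p k \<cdot>\<^sub>m (power_product m A t p * A (k + t))"
proof -
  have "A (k + t) * power_product m A t p
    = (\<Prod>i\<in>set [1..<Suc t]. (if i = k then exp_2pi_i (d k) else 1) ^ p i)
      \<cdot>\<^sub>m (power_product m A t p * A (k + t))"
    unfolding power_product_eq
    using assms le by (intro power_prod_list_scalar_commute carrier scalar_commute_dual) auto
  also have "(\<Prod>i\<in>set [1..<Suc t]. (if i = k then exp_2pi_i (d k) else 1) ^ p i)
      = (\<Prod>i\<in>{1..t}. if i = k then exp_2pi_i (d k) ^ p k else 1)"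
    by (intro prod.cong) auto
  also have "\<dots> = exp_2pi_i (d k) ^ p k"
    using assms by simp
  finally show ?thesis .
qed

lemma commute_power_product:
  assumes "B \<in> carrier_mat m m" "\<And>i. i \<in> {1..t} \<Longrightarrow> B * A i = A i * B"
  shows "B * power_product m A t p = power_product m A t p * B"
proof -
  have "B * power_product m A t p
    = (\<Prod>i\<in>set [1..<Suc t]. 1 ^ p i) \<cdot>\<^sub>m (power_product m A t p * B)"
    unfolding power_product_eq
    using assms le by (intro power_prod_list_scalar_commute carrier) (auto simp: one_smult_mat)
  then show ?thesis by (simp add: one_smult_mat)
qed

lemma mult_power_product:
  assumes "i \<in> {1..t}"
  shows "A i * power_product m A t p = power_product m A t (p(i := Suc (p i)))"
  unfolding power_product_eq
  using assms le by (intro mult_power_prod_list carrier commute_first) auto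

text \<open>The exponents are unbounded here: with \<open>a = q i\<close> this describes a full turn
  around the cycle of translates in direction \<open>i\<close>.\<close>

lemma pow_mult_power_product:
  assumes i: "i \<in> {1..t}"
  shows "A i ^\<^sub>m a * power_product m A t p = power_product m A t (p(i := p i + a))"
proof (induction a)
  case 0
  then show ?case
    using i le carrier[of i] left_mult_one_mat[OF power_product_carrier] by simp
next
  case (Suc a)
  have Ai: "A i \<in> carrier_mat m m" using i le by (intro carrier) auto
  have "A i ^\<^sub>m Suc a * power_product m A t p = A i * (A i ^\<^sub>m a * power_product m A t p)"
    using Ai power_product_carrier
    by (subst pow_mat_Suc_left[OF Ai]) (intro assoc_mult_mat[of _ m m _ m _ m], auto)
  then show ?case
    using Suc mult_power_product[OF i, of "p(i := p i + a)"]
    by (simp del: fun_upd_apply pow_mat.simps add: fun_upd_same)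
qed

definition common_eigenvector :: "complex vec \<Rightarrow> bool" where
  "common_eigenvector v \<longleftrightarrow> v \<in> carrier_vec m \<and> v \<bullet>c v = 1 \<and>
     (\<forall>i\<in>{t<..n}. \<exists>c. A i *\<^sub>v v = c \<cdot>\<^sub>v v) \<and> (\<forall>i\<in>{1..t}. \<exists>c. A i ^\<^sub>m q i *\<^sub>v v = c \<cdot>\<^sub>v v)"

lemma dual_translate:
  assumes v: "v \<in> carrier_vec m" and k: "k \<in> {1..t}" and eig: "A (k + t) *\<^sub>v v = c \<cdot>\<^sub>v v"
  shows "A (k + t) *\<^sub>v translate p v = (exp_2pi_i (d k) ^ p k * c) \<cdot>\<^sub>v translate p v"
proof -
  have Ak: "A (k + t) \<in> carrier_mat m m" using k le by (intro carrier) auto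
  note P = power_product_carrier[of p]
  have "A (k + t) *\<^sub>v translate p v = (A (k + t) * power_product m A t p) *\<^sub>v v"
    using Ak P v by (simp add: assoc_mult_mat_vec[of _ m m _ m])
  also have "\<dots> = exp_2pi_i (d k) ^ p k \<cdot>\<^sub>v ((power_product m A t p * A (k + t)) *\<^sub>v v)"
    unfolding dual_power_product[OF k] using Ak P v by (intro smult_mat_mult_vec) auto
  also have "(power_product m A t p * A (k + t)) *\<^sub>v v = c \<cdot>\<^sub>v translate p v"
    using Ak P v by (simp add: assoc_mult_mat_vec[of _ m m _ m] eig mult_mat_vec[of _ m m])
  finally show ?thesis by (simp add: smult_smult_assoc)
qed

text \<open>Applied both to \<open>A i\<close> with \<open>i > 2 * t\<close> and to the power
  \<open>A i ^ |d i|\<close> with \<open>i \<le> t\<close>.\<close>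

lemma commuting_translate:
  assumes v: "v \<in> carrier_vec m" and B: "B \<in> carrier_mat m m"
    and comm: "\<And>i. i \<in> {1..t} \<Longrightarrow> B * A i = A i * B" and eig: "B *\<^sub>v v = c \<cdot>\<^sub>v v"
  shows "B *\<^sub>v translate p v = c \<cdot>\<^sub>v translate p v"
proof -
  note P = power_product_carrier[of p]
  have "B * power_product m A t p = power_product m A t p * B"
    using B comm by (rule commute_power_product)
  then have "(B * power_product m A t p) *\<^sub>v v = (power_product m A t p * B) *\<^sub>v v"
    by (rule arg_cong)
  moreover have "B *\<^sub>v translate p v = (B * power_product m A t p) *\<^sub>v v"
    using B P v by (simp add: assoc_mult_mat_vec[of _ m m _ m])
  moreover have "(power_product m A t p * B) *\<^sub>v v = c \<cdot>\<^sub>v translate p v"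
    using B P v by (simp add: assoc_mult_mat_vec[of _ m m _ m] eig mult_mat_vec[of _ m m])
  ultimately show ?thesis by simp
qed

lemma common_eigenvector_nonzero: "common_eigenvector v \<Longrightarrow> v \<noteq> 0\<^sub>v m"
  by (auto simp: common_eigenvector_def)

lemma translate_norm: "common_eigenvector v \<Longrightarrow> translate p v \<bullet>c translate p v = 1"
  using cscalar_prod_unitary[OF power_product_unitary] by (simp add: common_eigenvector_def)

text \<open>Distinct exponents in position \<open>i\<close> give distinct eigenvalues of \<open>A (i + t)\<close>.\<close>

lemma translate_orthogonal:
  assumes v: "common_eigenvector v" and p: "p \<in> admissible" "p' \<in> admissible"
    and i: "i \<in> {1..t}" "p i \<noteq> p' i"
  shows "translate p v \<bullet>c translate p' v = 0"
proof -
  have vm: "v \<in> carrier_vec m" using v by (simp add: common_eigenvector_def)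
  let ?x = "translate p v" and ?y = "translate p' v" and ?g = "exp_2pi_i (d i)"
  have iN: "i + t \<in> {1..n}" "i + t \<in> {t<..n}" using i le by auto
  obtain c where c: "A (i + t) *\<^sub>v v = c \<cdot>\<^sub>v v"
    using v iN(2) unfolding common_eigenvector_def by blast
  have "cmod c = 1"
    using unitary_eigenvalue_norm[OF unitary[OF iN(1)] vm common_eigenvector_nonzero[OF v] c] .
  then have cc: "c * cnj c = 1" by (simp flip: complex_norm_square)
  have gg: "?g * cnj ?g = 1" by (simp flip: complex_norm_square)
  then have ggk: "?g ^ k * cnj ?g ^ k = 1" for k by (metis power_mult_distrib power_one)
  \<comment> \<open>Applying the unitary \<open>A (i + t)\<close> to both vectors preserves the
    product, yet multiplies it by a quotient of two powers of \<gamma>; the eigenvalue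
    \<open>c\<close> of \<open>v\<close> cancels, having modulus 1. The product must vanish unless
    those powers agree.\<close>
  have "?x \<bullet>c ?y = (A (i + t) *\<^sub>v ?x) \<bullet>c (A (i + t) *\<^sub>v ?y)"
    using cscalar_prod_unitary[OF unitary[OF iN(1)]] vm by simp
  also have "\<dots> = (?g ^ p i * c) * cnj (?g ^ p' i * c) * (?x \<bullet>c ?y)"
    unfolding dual_translate[OF vm i(1) c] using vm by (intro cscalar_prod_smult[of _ m]) auto
  also have "\<dots> = ?g ^ p i * cnj ?g ^ p' i * (c * cnj c) * (?x \<bullet>c ?y)"
    by (simp add: mult_ac)
  finally have "(?g ^ p i * cnj ?g ^ p' i - 1) * (?x \<bullet>c ?y) = 0"
    by (simp add: cc algebra_simps)
  moreover have "?g ^ p i * cnj ?g ^ p' i \<noteq> 1"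
  proof
    assume "?g ^ p i * cnj ?g ^ p' i = 1"
    then have "?g ^ p i * (cnj ?g ^ p' i * ?g ^ p' i) = ?g ^ p' i"
      by (metis mult.assoc mult_1)
    then have "?g ^ p i = ?g ^ p' i"
      using ggk[of "p' i"] by (simp add: mult.commute)
    then show False
      using exp_2pi_i_power_inj[of "p i" "d i" "p' i"] p i by (auto simp: admissible_def)
  qed
  ultimately show ?thesis by simp
qed

lemma translate_orthonormal:
  assumes "common_eigenvector v" "p \<in> admissible" "p' \<in> admissible"
  shows "translate p v \<bullet>c translate p' v = (if \<forall>i\<in>{1..t}. p i = p' i then 1 else 0)"
proof (cases "\<forall>i\<in>{1..t}. p i = p' i")
  case True
  then have "power_product m A t p = power_product m A t p'"
    unfolding power_product_def by (intro foldr_cong) auto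
  then show ?thesis using True translate_norm[OF assms(1)] by simp
next
  case False
  then show ?thesis using translate_orthogonal[OF assms] by auto
qed

text \<open>If \<open>p i = 0\<close>, the predecessor has exponent \<open>|d i| - 1\<close> at \<open>i\<close>, since \<open>v\<close> is an eigenvector of
  \<open>A i ^ |d i|\<close>.\<close>

lemma translate_predecessor:
  assumes v: "common_eigenvector v" and p: "p \<in> admissible" and i: "i \<in> {1..t}"
  shows "\<exists>c. \<exists>p'\<in>admissible. translate p v = c \<cdot>\<^sub>v (A i *\<^sub>v translate p' v)"
proof -
  have vm: "v \<in> carrier_vec m" using v by (simp add: common_eigenvector_def)
  have Ai: "A i \<in> carrier_mat m m" using i le by (intro carrier) auto
  have step: "A i *\<^sub>v translate p' v = translate (p'(i := Suc (p' i))) v" for p'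
    using Ai vm power_product_carrier[of p'] mult_power_product[OF i, of p']
    by (simp flip: assoc_mult_mat_vec[of _ m m _ m])
  show ?thesis
  proof (cases "p i")
    case (Suc a)
    have "p i < q i" using p i by (simp add: admissible_def)
    then have "p(i := a) \<in> admissible" using p Suc by (auto simp: admissible_def)
    moreover have "translate p v = 1 \<cdot>\<^sub>v (A i *\<^sub>v translate (p(i := a)) v)"
      unfolding step using Suc by (simp add: fun_upd_idem)
    ultimately show ?thesis by blast
  next
    case 0
    let ?p' = "p(i := q i - 1)"
    obtain b where b: "A i ^\<^sub>m q i *\<^sub>v v = b \<cdot>\<^sub>v v"
      using v i unfolding common_eigenvector_def by blast
    have "A i ^\<^sub>m q i \<in> carrier (unitary_group m)"
      using i le by (intro unitary_group_pow unitary) auto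
    then have "cmod b = 1"
      using unitary_eigenvalue_norm vm common_eigenvector_nonzero[OF v] b by blast
    then have b0: "b \<noteq> 0" by auto
    have "?p' \<in> admissible" using p by (auto simp: admissible_def qz_order_pos)
    moreover have "A i *\<^sub>v translate ?p' v = b \<cdot>\<^sub>v translate p v"
    proof -
      \<comment> \<open>Since \<open>p i = 0\<close> and \<open>q i > 0\<close>, raising
        \<open>q i - 1\<close> by one gives \<open>p i + q i\<close>, so a full power
        \<open>A i ^ |d i|\<close> splits off in front of the translate by \<open>p\<close>.\<close>
      have "A i *\<^sub>v translate ?p' v = translate (p(i := p i + q i)) v"
        unfolding step using qz_order_pos[of "d i"] 0 by simp
      also have "\<dots> = A i ^\<^sub>m q i *\<^sub>v translate p v"
        unfolding pow_mult_power_product[OF i, symmetric]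
        using Ai vm power_product_carrier[of p] by (intro assoc_mult_mat_vec[of _ m m _ m]) auto
      also have "\<dots> = b \<cdot>\<^sub>v translate p v"
      proof (rule commuting_translate[OF vm _ _ b])
        fix j assume j: "j \<in> {1..t}"
        then show "A i ^\<^sub>m q i * A j = A j * A i ^\<^sub>m q i"
          using i le commute_first[OF j i] by (intro commute_pow[symmetric, of _ m] carrier) auto
      qed (use Ai in auto)
      finally show ?thesis .
    qed
    then have "translate p v = inverse b \<cdot>\<^sub>v (A i *\<^sub>v translate ?p' v)"
      using b0 by (simp add: smult_smult_assoc)
    ultimately show ?thesis by blast
  qed
qed

section \<open>Maximal families of common eigenvectors\<close>

abbreviation "\<sigma> \<equiv> (\<Prod>i=1..t. q i)"

text \<open>Translates of a single \<open>v j\<close> are handled by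
  \<open>translate_orthogonal\<close>, so orthogonality is demanded across different
  \<open>j\<close>.\<close>

definition adapted :: "nat \<Rightarrow> (nat \<Rightarrow> complex vec) \<Rightarrow> bool" where
  "adapted k v \<longleftrightarrow> (\<forall>j\<in>{1..k}. common_eigenvector (v j)) \<and>
     (\<forall>p\<in>admissible. \<forall>p'\<in>admissible. \<forall>j\<in>{1..k}. \<forall>j'\<in>{1..k}.
        j \<noteq> j' \<longrightarrow> translate p (v j) \<bullet>c translate p' (v j') = 0)"

definition translates :: "nat \<Rightarrow> (nat \<Rightarrow> complex vec) \<Rightarrow> complex vec set" where
  "translates k v = {translate p (v j) | p j. p \<in> admissible \<and> j \<in> {1..k}}"

text \<open>Only the exponents in \<open>{1..t}\<close> matter, so restricting them gives a finite index set.\<close>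

definition exponents :: "(nat \<Rightarrow> nat) set" where
  "exponents = (\<Pi>\<^sub>E i\<in>{1..t}. {..<q i})"

lemma exponents_subset: "exponents \<subseteq> admissible"
  by (auto simp: exponents_def admissible_def)

lemma card_exponents: "card exponents = \<sigma>"
  by (simp add: exponents_def card_PiE)

lemma finite_exponents: "finite exponents"
  by (simp add: exponents_def finite_PiE)

lemma power_product_restrict: "power_product m A t (restrict p {1..t}) = power_product m A t p"
  unfolding power_product_def by (intro foldr_cong) auto

lemma restrict_exponents: "p \<in> admissible \<Longrightarrow> restrict p {1..t} \<in> exponents"
  by (auto simp: exponents_def admissible_def)

lemma translates_eq: "translates k v = (\<lambda>(p, j). translate p (v j)) ` (exponents \<times> {1..k})"
proof (rule equalityI)
  show "translates k v \<subseteq> (\<lambda>(p, j). translate p (v j)) ` (exponents \<times> {1..k})"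
  proof
    fix w assume "w \<in> translates k v"
    then obtain p j where pj: "p \<in> admissible" "j \<in> {1..k}" "w = translate p (v j)"
      by (auto simp: translates_def)
    then have "w = translate (restrict p {1..t}) (v j)" by (simp only: power_product_restrict)
    then show "w \<in> (\<lambda>(p, j). translate p (v j)) ` (exponents \<times> {1..k})"
      using restrict_exponents[OF pj(1)] pj(2) by force
  qed
  show "(\<lambda>(p, j). translate p (v j)) ` (exponents \<times> {1..k}) \<subseteq> translates k v"
  proof (rule image_subsetI, clarify)
    fix p j assume "p \<in> exponents" "j \<in> {1..k}"
    then show "translate p (v j) \<in> translates k v"
      using exponents_subset unfolding translates_def by blast
  qed
qed

lemma adapted_cscalar_prod:
  assumes "adapted k v" "p \<in> admissible" "p' \<in> admissible" "j \<in> {1..k}" "j' \<in> {1..k}"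
  shows "translate p (v j) \<bullet>c translate p' (v j')
    = (if j = j' \<and> (\<forall>i\<in>{1..t}. p i = p' i) then 1 else 0)"
proof (cases "j = j'")
  case True
  have "common_eigenvector (v j)" using assms by (simp add: adapted_def)
  from translate_orthonormal[OF this assms(2,3)] True show ?thesis by simp
next
  case False
  then show ?thesis using assms unfolding adapted_def by auto
qed

lemma exponents_eqI:
  assumes "p \<in> exponents" "p' \<in> exponents" "\<forall>i\<in>{1..t}. p i = p' i"
  shows "p = p'"
  using assms unfolding exponents_def by (intro PiE_ext[of p _ _ p']) auto

text \<open>Equal translates have inner product 1, whereas different indices give 0. Hence the
  family has exactly \<open>k * \<sigma>\<close> members.\<close>

lemma inj_on_translate:
  assumes "adapted k v"
  shows "inj_on (\<lambda>(p, j). translate p (v j)) (exponents \<times> {1..k})"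
proof (rule inj_onI, clarify)
  fix p j p' j' assume p: "p \<in> exponents" "p' \<in> exponents" and j: "j \<in> {1..k}" "j' \<in> {1..k}"
    and eq: "translate p (v j) = translate p' (v j')"
  have pa: "p \<in> admissible" "p' \<in> admissible" using p exponents_subset by auto
  have "translate p (v j) \<bullet>c translate p' (v j') = 1"
    using adapted_cscalar_prod[OF assms pa(1,1) j(1,1)] eq by simp
  then have "j = j' \<and> (\<forall>i\<in>{1..t}. p i = p' i)"
    using adapted_cscalar_prod[OF assms pa j] by (auto split: if_splits)
  then show "p = p' \<and> j = j'" using exponents_eqI[OF p] by auto
qed

lemma finite_translates: "finite (translates k v)"
  unfolding translates_eq using finite_exponents by simp

lemma card_translates: "adapted k v \<Longrightarrow> card (translates k v) = k * \<sigma>"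
  unfolding translates_eq
  by (subst card_image[OF inj_on_translate]) (simp_all add: card_cartesian_product card_exponents)

lemma translates_carrier: "adapted k v \<Longrightarrow> translates k v \<subseteq> carrier_vec m"
  by (auto simp: translates_def adapted_def common_eigenvector_def)

lemma orthonormal_translates:
  assumes "adapted k v"
  shows "orthonormal (translates k v)"
  unfolding orthonormal_def
proof (intro ballI)
  fix u w assume "u \<in> translates k v" "w \<in> translates k v"
  then obtain p j p' j' where u: "u = translate p (v j)" "p \<in> exponents" "j \<in> {1..k}"
    and w: "w = translate p' (v j')" "p' \<in> exponents" "j' \<in> {1..k}"
    unfolding translates_eq by auto
  have pa: "p \<in> admissible" "p' \<in> admissible" using u w exponents_subset by auto
  have "u = w \<longleftrightarrow> p = p' \<and> j = j'"
    using inj_onD[OF inj_on_translate[OF assms], of "(p, j)" "(p', j')"] u w by auto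
  then show "u \<bullet>c w = (if u = w then 1 else 0)"
    using adapted_cscalar_prod[OF assms pa u(3) w(3)] exponents_eqI[OF u(2) w(2)] u(1) w(1)
    by auto
qed

abbreviation "complement k v \<equiv> {u \<in> carrier_vec m. \<forall>w\<in>translates k v. u \<bullet>c w = 0}"

text \<open>For \<open>i \<le> t\<close> each translate comes from its predecessor in direction
  \<open>i\<close>. For \<open>i > t\<close> each translate is an eigenvector of \<open>A i\<close>
  with eigenvalue of modulus 1, so it comes from itself after division by that eigenvalue.\<close>

lemma complement_invariant:
  assumes v: "adapted k v" and i: "i \<in> {1..n}"
  shows "invariant_under (A i) (complement k v)"
proof (rule invariant_under_orthogonal[OF unitary[OF i] translates_carrier[OF v]])
  fix w assume "w \<in> translates k v"
  then obtain p j where w: "w = translate p (v j)" and p: "p \<in> admissible" and j: "j \<in> {1..k}"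
    by (auto simp: translates_def)
  have ev: "common_eigenvector (v j)" and vm: "v j \<in> carrier_vec m"
    using v j by (auto simp: adapted_def common_eigenvector_def)
  show "\<exists>c w'. w' \<in> translates k v \<and> w = c \<cdot>\<^sub>v (A i *\<^sub>v w')"
  proof (cases "i \<le> t")
    case True
    then obtain c p' where "p' \<in> admissible" "w = c \<cdot>\<^sub>v (A i *\<^sub>v translate p' (v j))"
      using translate_predecessor[OF ev p, of i] i w by auto
    then show ?thesis using j unfolding translates_def by blast
  next
    case False
    then obtain c where c: "A i *\<^sub>v v j = c \<cdot>\<^sub>v v j"
      using ev i unfolding common_eigenvector_def by fastforce
    have "\<exists>c. A i *\<^sub>v w = c \<cdot>\<^sub>v w"
    proof (cases "i \<le> 2 * t")
      case True
      then have "i - t \<in> {1..t}" "i = (i - t) + t" using False i by auto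
      then show ?thesis using dual_translate[OF vm, of "i - t" c p] c w by auto
    next
      case False
      have "A i *\<^sub>v w = c \<cdot>\<^sub>v w"
        unfolding w using c False i le by (intro commuting_translate[OF vm] commute carrier) (auto simp: D_matrix_def)
      then show ?thesis by blast
    qed
    then obtain b where b: "A i *\<^sub>v w = b \<cdot>\<^sub>v w" by blast
    have wm: "w \<in> carrier_vec m" using vm w by simp
    have "w \<noteq> 0\<^sub>v m" using translate_norm[OF ev, of p] w by auto
    then have "cmod b = 1" using unitary_eigenvalue_norm[OF unitary[OF i] wm _ b] by simp
    then have "b \<noteq> 0" by auto
    then have "w = inverse b \<cdot>\<^sub>v (A i *\<^sub>v w)" by (simp add: b smult_smult_assoc)
    then show ?thesis using \<open>w \<in> translates k v\<close> by blast
  qed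
qed

text \<open>The only index that might not commute with \<open>A i\<close> is \<open>i + t\<close>,
  and there the scalar \<gamma> is raised to the order of \<open>d i\<close>, which gives 1.\<close>

lemma pow_order_commute:
  assumes i: "i \<in> {1..t}" and j: "j \<in> {1..n}"
  shows "A j * A i ^\<^sub>m q i = A i ^\<^sub>m q i * A j"
proof -
  have iN: "i \<in> {1..n}" using i le by auto
  let ?z = "exp_2pi_i (D_matrix t d j i)"
  have "A j * A i ^\<^sub>m q i = ?z ^ q i \<cdot>\<^sub>m (A i ^\<^sub>m q i * A j)"
    using i j iN by (intro scalar_commute_pow[of _ m] carrier scalar_commute)
  moreover have "?z ^ q i = 1"
  proof (cases "j = i + t")
    case True
    then show ?thesis using i by (simp add: D_matrix_def exp_2pi_i_power_qz_order)
  next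
    case False
    moreover have "\<not> i = j + t" using i j by auto
    ultimately show ?thesis by (simp add: D_matrix_def)
  qed
  ultimately show ?thesis by (simp add: one_smult_mat)
qed

lemma exists_common_eigenvector:
  assumes v: "adapted k v" and k: "k * \<sigma> < m"
  shows "\<exists>x. common_eigenvector x \<and> x \<in> complement k v"
proof -
  let ?S = "complement k v"
  obtain u where u: "u \<in> ?S" "u \<noteq> 0\<^sub>v m"
    using exists_orthogonal_vec[OF translates_carrier[OF v] finite_translates] k card_translates[OF v]
    by auto
  have S: "vec_subspace m ?S" by (rule vec_subspace_orthogonal[OF translates_carrier[OF v]])
  define \<A> where "\<A> = map A [Suc t..<Suc n] @ map (\<lambda>i. A i ^\<^sub>m q i) [1..<Suc t]"
  have \<A>: "set \<A> = A ` {t<..n} \<union> (\<lambda>i. A i ^\<^sub>m q i) ` {1..t}"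
    by (auto simp: \<A>_def image_iff)
  have "set \<A> \<subseteq> carrier_mat m m"
    unfolding \<A> using le carrier by (auto intro!: pow_carrier_mat)
  moreover have "B * C = C * B" if "B \<in> set \<A>" "C \<in> set \<A>" for B C
  proof -
    \<comment> \<open>Every nonzero entry of \<open>D_matrix\<close> involves an index at most
      \<open>t\<close>.\<close>
    have 1: "A i * A j = A j * A i" if "i \<in> {t<..n}" "j \<in> {t<..n}" for i j
      using that le by (intro commute) (auto simp: D_matrix_def)
    have 2: "A j * A i ^\<^sub>m q i = A i ^\<^sub>m q i * A j" if "i \<in> {1..t}" "j \<in> {t<..n}" for i j
      using that by (intro pow_order_commute) auto
    have 3: "A j ^\<^sub>m q j * A i ^\<^sub>m q i = A i ^\<^sub>m q i * A j ^\<^sub>m q j"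
      if ij: "i \<in> {1..t}" "j \<in> {1..t}" for i j
    proof -
      have carr: "A i \<in> carrier_mat m m" "A j \<in> carrier_mat m m"
        using ij le by (auto intro!: carrier)
      have "A i ^\<^sub>m q i * A j = A j * A i ^\<^sub>m q i"
        using ij le by (intro pow_order_commute[symmetric]) auto
      then show ?thesis
        using commute_pow[of "A j" m "A i ^\<^sub>m q i" "q j"] carr by simp
    qed
    show ?thesis using that unfolding \<A> using 1 2 3 by (elim UnE imageE) metis+
  qed
  moreover have "invariant_under B ?S" if "B \<in> set \<A>" for B
  proof -
    have "invariant_under (A i ^\<^sub>m r) ?S" if "i \<in> {1..n}" for i r
      using that by (intro invariant_under_pow[OF carrier _ complement_invariant[OF v]]) auto
    moreover have "invariant_under (A i) ?S" if "i \<in> {t<..n}" for i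
      using that by (intro complement_invariant[OF v]) auto
    ultimately show ?thesis using that le unfolding \<A> by fastforce
  qed
  ultimately obtain w where w: "w \<in> ?S" "w \<noteq> 0\<^sub>v m" "\<forall>B\<in>set \<A>. \<exists>c. B *\<^sub>v w = c \<cdot>\<^sub>v w"
    using common_eigenvector_in_subspace[OF _ _ S _ u] by blast
  have wm: "w \<in> carrier_vec m" using w by simp
  \<comment> \<open>Positivity in the order of the complex numbers includes a vanishing imaginary
    part, so \<open>r\<close> is the squared norm of \<open>w\<close> and scaling by
    \<open>1 / sqrt r\<close> normalises it.\<close>
  define r where "r = Re (w \<bullet>c w)"
  have "w \<bullet>c w > 0"
    using w(2) wm conjugate_square_greater_0_vec[OF wm] by simp
  then have r: "r > 0" "w \<bullet>c w = of_real r"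
    by (auto simp: r_def less_complex_def complex_eq_iff)
  define x where "x = complex_of_real (1 / sqrt r) \<cdot>\<^sub>v w"
  have "x \<bullet>c x = of_real (1 / sqrt r * (1 / sqrt r) * r)"
    unfolding x_def cscalar_prod_smult[OF wm wm] r(2) complex_cnj_complex_of_real of_real_mult ..
  moreover have "1 / sqrt r * (1 / sqrt r) * r = 1" using r(1) by (simp add: field_simps)
  ultimately have "x \<bullet>c x = 1" by (simp only: of_real_1)
  moreover have "x \<in> ?S"
    using S w(1) unfolding vec_subspace_def x_def by blast
  moreover have "\<exists>c. B *\<^sub>v x = c \<cdot>\<^sub>v x" if B: "B \<in> set \<A>" for B
  proof -
    obtain c where c: "B *\<^sub>v w = c \<cdot>\<^sub>v w" using w B by blast
    have "B \<in> carrier_mat m m" using B \<open>set \<A> \<subseteq> carrier_mat m m\<close> by auto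
    then have "B *\<^sub>v x = c \<cdot>\<^sub>v x"
      using wm by (simp add: x_def mult_mat_vec[of _ m m] c smult_smult_assoc mult.commute)
    then show ?thesis by blast
  qed
  ultimately show ?thesis
    unfolding common_eigenvector_def \<A> by (intro exI[of _ x]) auto
qed

text \<open>A single vector \<open>x\<close> in the complement suffices: the complement is invariant
  under all \<open>A i\<close>, hence contains every translate of \<open>x\<close>.\<close>

lemma adapted_extend:
  assumes v: "adapted k v" and k: "k * \<sigma> < m"
  shows "\<exists>v'. adapted (Suc k) v'"
proof -
  obtain x where x: "common_eigenvector x" "x \<in> complement k v"
    using exists_common_eigenvector[OF assms] by blast
  let ?v' = "v(Suc k := x)"
  have inv: "invariant_under (power_product m A t p) (complement k v)" for p
    unfolding power_product_eq using le
    by (intro invariant_under_power_prod_list complement_invariant[OF v] carrier) auto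
  have new: "translate p x \<bullet>c translate p' (v j) = 0"
    if "p' \<in> admissible" "j \<in> {1..k}" for p p' j
  proof -
    have "translate p x \<in> complement k v"
      using inv[of p] x(2) unfolding invariant_under_def by blast
    moreover have "translate p' (v j) \<in> translates k v"
      using that by (auto simp: translates_def)
    ultimately show ?thesis by blast
  qed
  have new': "translate p' (v j) \<bullet>c translate p x = 0"
    if "p' \<in> admissible" "j \<in> {1..k}" for p p' j
  proof -
    have "v j \<in> carrier_vec m" "x \<in> carrier_vec m"
      using v x that by (auto simp: adapted_def common_eigenvector_def)
    then show ?thesis
      using cscalar_prod_commute[of "translate p' (v j)" m "translate p x"] new[OF that] by simp
  qed
  have "adapted (Suc k) ?v'"
    unfolding adapted_def
  proof (intro conjI ballI impI)
    fix j assume "j \<in> {1..Suc k}"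
    then show "common_eigenvector (?v' j)"
      using v x by (cases "j = Suc k") (auto simp: adapted_def)
  next
    fix p p' j j' assume *: "p \<in> admissible" "p' \<in> admissible" "j \<in> {1..Suc k}" "j' \<in> {1..Suc k}"
      "j \<noteq> j'"
    then consider "j = Suc k" "j' \<in> {1..k}" | "j' = Suc k" "j \<in> {1..k}"
      | "j \<in> {1..k}" "j' \<in> {1..k}" by fastforce
    then show "translate p (?v' j) \<bullet>c translate p' (?v' j') = 0"
    proof cases
      case 1
      then show ?thesis using new * by simp
    next
      case 2
      then show ?thesis using new' * by simp
    next
      case 3
      then have "?v' j = v j" "?v' j' = v j'" by auto
      then show ?thesis using v 3 * unfolding adapted_def by simp
    qed
  qed
  then show ?thesis by blast
qed

lemma \<sigma>_pos: "\<sigma> > 0"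
  by (simp add: prod_pos qz_order_pos)

text \<open>If \<open>k * \<sigma>\<close> never hit \<open>m\<close>, families of every size would
  exist; size \<open>Suc m\<close> contradicts the bound \<open>k * \<sigma> \<le> m\<close> because
  \<open>\<sigma> \<ge> 1\<close>.\<close>

lemma exists_adapted: "\<exists>k v. adapted k v \<and> k * \<sigma> = m"
proof (rule ccontr)
  assume no: "\<not> ?thesis"
  have "\<exists>v. adapted k v" for k
  proof (induction k)
    case 0
    then show ?case by (simp add: adapted_def)
  next
    case (Suc k)
    then obtain v where v: "adapted k v" by blast
    have "k * \<sigma> \<le> m"
      using orthonormal_card_le[OF orthonormal_translates[OF v] translates_carrier[OF v]
          finite_translates] card_translates[OF v] by simp
    moreover have "k * \<sigma> \<noteq> m" using no v by blast
    ultimately show ?case using adapted_extend[OF v] by simp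
  qed
  then obtain v where v: "adapted (Suc m) v" by blast
  have "Suc m * \<sigma> \<le> m"
    using orthonormal_card_le[OF orthonormal_translates[OF v] translates_carrier[OF v]
        finite_translates] card_translates[OF v] by simp
  moreover have "Suc m * Suc 0 \<le> Suc m * \<sigma>"
    using \<sigma>_pos by (intro mult_le_mono2 Suc_leI)
  ultimately show False by simp
qed

end

section \<open>Clock and shift matrices\<close>

text \<open>Sends the basis vector with index s to \<open>c s\<close> times the one with index
  \<open>f s\<close>. A clock matrix has \<open>f\<close> the identity, a shift matrix has all
  \<open>c s\<close> equal to 1.\<close>

definition monomial_mat :: "nat \<Rightarrow> (nat \<Rightarrow> nat) \<Rightarrow> (nat \<Rightarrow> 'a) \<Rightarrow> 'a :: comm_semiring_1 mat" where
  "monomial_mat m f c = mat m m (\<lambda>(r, s). if r = f s then c s else 0)"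

lemma monomial_mat_carrier [simp]: "monomial_mat m f c \<in> carrier_mat m m"
  by (simp add: monomial_mat_def)

lemma monomial_mat_mult:
  assumes "g \<in> {..<m} \<rightarrow> {..<m}"
  shows "monomial_mat m f c * monomial_mat m g e = monomial_mat m (f \<circ> g) (\<lambda>s. c (g s) * e s)"
proof (rule eq_matI)
  fix r s assume "r < dim_row (monomial_mat m (f \<circ> g) (\<lambda>s. c (g s) * e s))"
    "s < dim_col (monomial_mat m (f \<circ> g) (\<lambda>s. c (g s) * e s))"
  then have rs: "r < m" "s < m" by (simp_all add: monomial_mat_def)
  then have "(monomial_mat m f c * monomial_mat m g e) $$ (r, s)
      = (\<Sum>k<m. (if r = f k then c k else 0) * (if k = g s then e s else 0))"
    by (simp add: monomial_mat_def scalar_prod_def atLeast0LessThan)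
  also have "\<dots> = (\<Sum>k<m. if k = g s then (if r = f (g s) then c (g s) * e s else 0) else 0)"
    by (intro sum.cong) auto
  also have "\<dots> = (if r = f (g s) then c (g s) * e s else 0)"
    using assms rs by (auto simp: Pi_iff)
  finally show "(monomial_mat m f c * monomial_mat m g e) $$ (r, s)
      = monomial_mat m (f \<circ> g) (\<lambda>s. c (g s) * e s) $$ (r, s)"
    using rs by (simp add: monomial_mat_def)
qed (simp_all add: monomial_mat_def)

lemma monomial_mat_cong:
  assumes "\<And>s. s < m \<Longrightarrow> f s = g s" "\<And>s. s < m \<Longrightarrow> c s = e s"
  shows "monomial_mat m f c = monomial_mat m g e"
  using assms by (auto simp: monomial_mat_def intro!: cong_mat)

lemma smult_monomial_mat: "z \<cdot>\<^sub>m monomial_mat m f c = monomial_mat m f (\<lambda>s. z * c s)"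
  by (intro eq_matI) (auto simp: monomial_mat_def)

text \<open>Columns \<open>r\<close> and \<open>s\<close> have their entries in rows
  \<open>f r\<close> and \<open>f s\<close>, so injectivity of \<open>f\<close> makes the columns
  orthonormal; for a square matrix this suffices.\<close>

lemma monomial_mat_unitary:
  assumes f: "f \<in> {..<m} \<rightarrow> {..<m}" "inj_on f {..<m}" and c: "\<And>s. s < m \<Longrightarrow> cmod (c s) = 1"
  shows "monomial_mat m f c \<in> carrier (unitary_group m)"
proof -
  let ?M = "monomial_mat m f c"
  have "mat_adjoint ?M * ?M = 1\<^sub>m m"
  proof (rule eq_matI)
    fix r s assume "r < dim_row (1\<^sub>m m :: complex mat)" "s < dim_col (1\<^sub>m m :: complex mat)"
    then have rs: "r < m" "s < m" by simp_all
    then have "(mat_adjoint ?M * ?M) $$ (r, s)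
        = (\<Sum>k<m. cnj (if k = f r then c r else 0) * (if k = f s then c s else 0))"
      by (simp add: monomial_mat_def mat_adjoint_index scalar_prod_def atLeast0LessThan)
    also have "\<dots> = (\<Sum>k<m. if k = f s then (if f r = f s then cnj (c r) * c s else 0) else 0)"
      by (intro sum.cong) auto
    also have "\<dots> = (if f r = f s then cnj (c r) * c s else 0)"
      using f rs by (auto simp: Pi_iff)
    also have "\<dots> = (if r = s then cnj (c r) * c r else 0)"
      using inj_onD[OF f(2), of r s] rs by auto
    also have "cnj (c r) * c r = 1"
      using c[OF rs(1)] complex_norm_square[of "c r"] by (simp add: mult.commute)
    finally show "(mat_adjoint ?M * ?M) $$ (r, s) = 1\<^sub>m m $$ (r, s)" using rs by simp
  qed (simp_all add: monomial_mat_def)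
  moreover from this have "?M * mat_adjoint ?M = 1\<^sub>m m"
    by (rule mat_mult_left_right_inverse[rotated 2]) simp_all
  ultimately show ?thesis by (simp add: unitary_group_def)
qed

lemma power_mod_order:
  fixes z :: "'a :: monoid_mult"
  assumes "z ^ q = 1"
  shows "z ^ (a mod q) = z ^ a"
proof -
  have "z ^ a = z ^ (q * (a div q) + a mod q)" by simp
  also have "\<dots> = z ^ (a mod q)" by (simp only: power_add power_mult assms power_one mult_1)
  finally show ?thesis ..
qed

text \<open>Generalised clock and shift matrices. The standard basis is indexed by pairs of a digit
  vector \<open>p\<close> with \<open>p i < |d i|\<close> and a multiplicity index below \<open>m / \<sigma>\<close>; \<open>A i\<close> raises digit \<open>i\<close>
  cyclically, and \<open>A (i + t)\<close> is diagonal with entries \<open>\<gamma> i ^ p i\<close>.\<close>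

lemma almost_commuting_tuples_nonempty:
  assumes le: "2 * t \<le> n" and dvd: "(\<Prod>i=1..t. qz_order (d i)) dvd m"
  shows "almost_commuting_tuples n m (D_matrix t d) \<noteq> {}"
proof -
  let ?q = "\<lambda>i. qz_order (d i)" and ?g = "\<lambda>i. exp_2pi_i (d i)"
  obtain l where m: "m = (\<Prod>i=1..t. ?q i) * l" using dvd by (rule dvdE)
  define X where "X = (\<Pi>\<^sub>E i\<in>{1..t}. {..<?q i}) \<times> {..<l}"
  have "finite X" "card X = m"
    by (simp_all add: X_def finite_PiE card_cartesian_product card_PiE m)
  \<comment> \<open>Matrix indices are numbers below \<open>m\<close>; \<open>h\<close> and its
    inverse \<open>g\<close> transport the construction from \<open>X\<close> to them.\<close>
  then obtain h where h: "bij_betw h {..<m} X"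
    using ex_bij_betw_nat_finite[of X] by (auto simp: atLeast0LessThan)
  define g where "g = inv_into {..<m} h"
  have hX: "h s \<in> X" if "s < m" for s using h that by (auto simp: bij_betw_def)
  have gm: "g x < m" "h (g x) = x" if "x \<in> X" for x
    using h that inv_into_into[of x h "{..<m}"] f_inv_into_f[of x h "{..<m}"]
    by (auto simp: bij_betw_def g_def)
  have gh: "g (h s) = s" if "s < m" for s
    using h that by (simp add: g_def bij_betw_def)
  define shift where
    "shift i x = ((fst x)(i := Suc (fst x i) mod ?q i), snd x)" for i and x :: "(nat \<Rightarrow> nat) \<times> nat"
  have shiftX: "shift i x \<in> X" if "i \<in> {1..t}" "x \<in> X" for i x
    using that by (auto simp: X_def shift_def PiE_iff qz_order_pos extensional_def)
  have shift_inj: "x = y" if i: "i \<in> {1..t}" and xy: "x \<in> X" "y \<in> X" "shift i x = shift i y" for i x y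
  proof -
    have lt: "fst x i < ?q i" "fst y i < ?q i" using i xy by (auto simp: X_def PiE_iff)
    have eq: "((fst x)(i := Suc (fst x i) mod ?q i)) k = ((fst y)(i := Suc (fst y i) mod ?q i)) k" for k
      using xy(3) by (simp add: shift_def)
    have "fst x i = fst y i"
      using eq[of i] lt by (auto simp: mod_Suc split: if_splits)
    moreover have "fst x k = fst y k" if "k \<noteq> i" for k using eq[of k] that by simp
    ultimately have "fst x = fst y" by (intro ext) metis
    then show ?thesis using xy(3) by (simp add: shift_def prod_eq_iff)
  qed
  have shift_commute: "shift i (shift j x) = shift j (shift i x)" for i j x
    by (auto simp: shift_def fun_eq_iff)
  \<comment> \<open>The defaults, identity map and coefficient 1, let one formula cover all
    \<open>i\<close>: a shift for \<open>i \<le> t\<close>, a clock for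
    \<open>t < i \<le> 2 * t\<close>, and the identity matrix beyond.\<close>
  define f where "f i s = (if i \<in> {1..t} then g (shift i (h s)) else s)" for i s
  define c where "c i s = (if i \<in> {Suc t..2 * t} then ?g (i - t) ^ fst (h s) (i - t) else 1)" for i s
  have f: "f i \<in> {..<m} \<rightarrow> {..<m}" for i
    using gm(1)[OF shiftX[OF _ hX]] by (auto simp: f_def)
  have hf: "h (f i s) = shift i (h s)" if "i \<in> {1..t}" "s < m" for i s
    using gm(2)[OF shiftX[OF that(1) hX[OF that(2)]]] that by (simp add: f_def)
  have f_inj: "inj_on (f i) {..<m}" for i
  proof (rule inj_onI)
    fix s r assume sr: "s \<in> {..<m}" "r \<in> {..<m}" "f i s = f i r"
    show "s = r"
    proof (cases "i \<in> {1..t}")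
      case True
      have sr': "s < m" "r < m" using sr by auto
      have "shift i (h s) = shift i (h r)"
        using hf[OF True sr'(1)] hf[OF True sr'(2)] sr(3) by simp
      then have "h s = h r" by (rule shift_inj[OF True hX[OF sr'(1)] hX[OF sr'(2)]])
      then show ?thesis using gh[OF sr'(1)] gh[OF sr'(2)] by metis
    qed (use sr in \<open>auto simp: f_def\<close>)
  qed
  have f_commute: "f i (f j s) = f j (f i s)" if s: "s < m" for i j s
  proof (cases "i \<in> {1..t} \<and> j \<in> {1..t}")
    case True
    then have "f i (f j s) = g (shift i (shift j (h s)))" "f j (f i s) = g (shift j (shift i (h s)))"
      using s hf[of j s] hf[of i s] by (simp_all add: f_def[of i "f j s"] f_def[of j "f i s"])
    then show ?thesis by (simp add: shift_commute)
  qed (auto simp: f_def)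
  have c_shift: "c i (f j s) = (if j \<in> {1..t} \<and> i = j + t then ?g j else 1) * c i s"
    if s: "s < m" for i j s
  proof (cases "j \<in> {1..t} \<and> i \<in> {Suc t..2 * t}")
    case True
    \<comment> \<open>When the digit wraps around to 0, the clock entry still gains just one factor
      \<gamma>, as the power of \<gamma> depends on the exponent modulo |d j| only.\<close>
    have "?g j ^ (Suc a mod ?q j) = ?g j * ?g j ^ a" for a
      by (simp add: power_mod_order exp_2pi_i_power_qz_order)
    then show ?thesis
      using True hf[of j s] s by (auto simp: c_def shift_def)
  qed (auto simp: c_def f_def)
  define A where "A = (\<lambda>i\<in>{1..n}. monomial_mat m (f i) (c i))"
  have A_unitary: "A i \<in> carrier (unitary_group m)" if "i \<in> {1..n}" for i
    using that f f_inj by (auto simp: A_def c_def norm_power intro!: monomial_mat_unitary)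
  have comm: "A i * A j = exp_2pi_i (D_matrix t d i j) \<cdot>\<^sub>m (A j * A i)"
    if ij: "i \<in> {1..n}" "j \<in> {1..n}" for i j
  proof -
    let ?z = "exp_2pi_i (D_matrix t d i j)"
    \<comment> \<open>The underlying index maps commute, so the relation reduces to this identity of
      coefficients. Entries \<open>- d i\<close> of \<open>D_matrix\<close> are where
      \<open>exp_2pi_i_minus_mult\<close> enters.\<close>
    have "c i (f j s) * c j s = ?z * (c j (f i s) * c i s)" if s: "s < m" for s
      using exp_2pi_i_minus_mult[of "d i"]
      by (auto simp: c_shift[OF s] D_matrix_def mult_ac)
    then show ?thesis
      using ij f_commute
      by (auto simp: A_def monomial_mat_mult[OF f] smult_monomial_mat intro!: monomial_mat_cong)
  qed
  have "A \<in> {1..n} \<rightarrow>\<^sub>E carrier (unitary_group m)"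
    by (intro PiE_I A_unitary) (auto simp: A_def)
  then have "A \<in> almost_commuting_tuples n m (D_matrix t d)"
    unfolding almost_commuting_tuples_def
    by (intro CollectI conjI ballI commutator_eq_scalar_iff[THEN iffD2] A_unitary comm)
  then show ?thesis by blast
qed

section \<open>Criterion for non-emptiness and structure of an arbitrary tuple\<close>

theorem theorem3p3:
  fixes n m t :: nat
    and d :: "nat \<Rightarrow> rat_mod_int"
    and D :: "nat \<Rightarrow> nat \<Rightarrow> rat_mod_int"
    and \<gamma> :: "nat \<Rightarrow> complex"
    and \<sigma> :: nat
  assumes "2 * t \<le> n"
    and "\<forall>i\<in>{1..t}. d i \<noteq> 0"
    and "D = D_matrix t d"
    and "\<forall>i\<in>{1..t}. \<gamma> i = exp_2pi_i (d i)"
    and "\<sigma> = (\<Prod>i=1..t. qz_order (d i))"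
  shows
    "(almost_commuting_tuples n m D \<noteq> {} \<longleftrightarrow> \<sigma> dvd m) \<and>
     (\<sigma> dvd m \<longrightarrow>
       (\<forall>l A. l = m div \<sigma> \<longrightarrow> A \<in> almost_commuting_tuples n m D \<longrightarrow>
         (\<exists>(v :: nat \<Rightarrow> complex vec) (\<alpha> :: nat \<Rightarrow> nat \<Rightarrow> complex) (\<beta> :: nat \<Rightarrow> nat \<Rightarrow> complex).
            (\<forall>j\<in>{1..l}. v j \<in> carrier_vec m) \<and>
            (\<forall>j\<in>{1..l}. \<forall>k\<in>{1..l}. v j \<bullet>c v k = (if j = k then 1 else 0)) \<and>
            (\<forall>i\<in>{t<..n}. \<forall>j\<in>{1..l}. cmod (\<alpha> i j) = 1) \<and>
            (\<forall>i\<in>{1..t}. \<forall>j\<in>{1..l}. cmod (\<beta> i j) = 1) \<and>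
            orthonormal_basis m
              {power_product m A t p *\<^sub>v v j | p j.
                 (\<forall>i\<in>{1..t}. p i < qz_order (d i)) \<and> j \<in> {1..l}} \<and>
            (\<forall>p. \<forall>j\<in>{1..l}. (\<forall>i\<in>{1..t}. p i < qz_order (d i)) \<longrightarrow>
               (\<forall>i\<in>{t+1..2*t}.
                  eigenvector (A i) (power_product m A t p *\<^sub>v v j) (\<gamma> (i - t) ^ p (i - t) * \<alpha> i j)) \<and>
               (\<forall>i\<in>{2*t+1..n}.
                  eigenvector (A i) (power_product m A t p *\<^sub>v v j) (\<alpha> i j))) \<and>
            (\<forall>i\<in>{1..t}. \<forall>j\<in>{1..l}. (A i ^\<^sub>m qz_order (d i)) *\<^sub>v v j = \<beta> i j \<cdot>\<^sub>v v j))))"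
proof (intro conjI impI allI)
  show "almost_commuting_tuples n m D \<noteq> {} \<longleftrightarrow> \<sigma> dvd m"
  proof
    assume "almost_commuting_tuples n m D \<noteq> {}"
    then obtain A where "A \<in> almost_commuting_tuples n m D" by blast
    then interpret almost_commuting n m t d A
      using assms by unfold_locales simp_all
    show "\<sigma> dvd m" using exists_adapted assms(5) by (metis dvd_triv_right)
  next
    assume "\<sigma> dvd m"
    then show "almost_commuting_tuples n m D \<noteq> {}"
      using almost_commuting_tuples_nonempty[OF assms(1)] assms(3,5) by blast
  qed
next
  fix l A assume l: "l = m div \<sigma>" and A: "A \<in> almost_commuting_tuples n m D"
  interpret almost_commuting n m t d A
    using assms A by unfold_locales simp_all
  \<comment> \<open>Since \<open>\<sigma> > 0\<close>, the size of a family that fills the space can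
    only be \<open>m div \<sigma>\<close>.\<close>
  obtain v where v: "adapted l v" and lm: "l * \<sigma> = m"
    using exists_adapted \<sigma>_pos l assms(5) by (metis nonzero_mult_div_cancel_right less_irrefl)
  have ev: "common_eigenvector (v j)" if "j \<in> {1..l}" for j
    using v that by (simp add: adapted_def)
  then have vm: "v j \<in> carrier_vec m" and v0: "v j \<noteq> 0\<^sub>v m" if "j \<in> {1..l}" for j
    using common_eigenvector_nonzero[OF ev[OF that]] that by (auto simp: common_eigenvector_def)
  \<comment> \<open>Eigenvalues are picked from the existence statements in
    \<open>common_eigenvector\<close>; they are characterised only for the index ranges in the
    theorem.\<close>
  define \<alpha> where "\<alpha> i j = (SOME c. A i *\<^sub>v v j = c \<cdot>\<^sub>v v j)" for i j
  define \<beta> where "\<beta> i j = (SOME c. A i ^\<^sub>m qz_order (d i) *\<^sub>v v j = c \<cdot>\<^sub>v v j)" for i j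
  have \<alpha>: "A i *\<^sub>v v j = \<alpha> i j \<cdot>\<^sub>v v j" if "i \<in> {t<..n}" "j \<in> {1..l}" for i j
    unfolding \<alpha>_def using ev[OF that(2)] that(1)
    by (intro someI_ex[of "\<lambda>c. A i *\<^sub>v v j = c \<cdot>\<^sub>v v j"]) (simp add: common_eigenvector_def)
  have \<beta>: "A i ^\<^sub>m qz_order (d i) *\<^sub>v v j = \<beta> i j \<cdot>\<^sub>v v j" if "i \<in> {1..t}" "j \<in> {1..l}" for i j
    unfolding \<beta>_def using ev[OF that(2)] that(1)
    by (intro someI_ex[of "\<lambda>c. A i ^\<^sub>m qz_order (d i) *\<^sub>v v j = c \<cdot>\<^sub>v v j"])
      (simp add: common_eigenvector_def)
  \<comment> \<open>Each \<open>v j\<close> is its own translate with all exponents 0, which is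
    admissible because the orders are positive. Orthonormality of the \<open>v j\<close> is thus a
    case of that of the translates.\<close>
  have adm0: "(\<lambda>_. 0) \<in> admissible" by (simp add: admissible_def qz_order_pos)
  have translate0: "translate (\<lambda>_. 0) (v j) = v j" if "j \<in> {1..l}" for j
  proof -
    have "power_prod_list m A xs (\<lambda>_. 0) = 1\<^sub>m m" if "set xs \<subseteq> {1..n}" for xs
      using that
    proof (induction xs)
      case (Cons x xs)
      then have "dim_row (A x) = m" using carrier[of x] by simp
      then show ?case using Cons by simp
    qed simp
    from this[of "[1..<Suc t]"] have "power_product m A t (\<lambda>_. 0) = 1\<^sub>m m"
      unfolding power_product_eq using le by (simp del: upt_Suc add: subset_eq)
    then show ?thesis using vm[OF that] by simp
  qed
  have t0: "translate p (v j) \<noteq> 0\<^sub>v m" if "j \<in> {1..l}" for p j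
    using translate_norm[OF ev[OF that], of p] by auto
  have "{translate p (v j) |p j. (\<forall>i\<in>{1..t}. p i < qz_order (d i)) \<and> j \<in> {1..l}} = translates l v"
    by (simp add: translates_def admissible_def)
  then have basis: "orthonormal_basis m
      {translate p (v j) |p j. (\<forall>i\<in>{1..t}. p i < qz_order (d i)) \<and> j \<in> {1..l}}"
    using orthonormal_basisI[OF orthonormal_translates[OF v] translates_carrier[OF v] finite_translates]
      card_translates[OF v] lm assms(5) by simp
  show "\<exists>v \<alpha> \<beta>.
            (\<forall>j\<in>{1..l}. v j \<in> carrier_vec m) \<and>
            (\<forall>j\<in>{1..l}. \<forall>k\<in>{1..l}. v j \<bullet>c v k = (if j = k then 1 else 0)) \<and>
            (\<forall>i\<in>{t<..n}. \<forall>j\<in>{1..l}. cmod (\<alpha> i j) = 1) \<and>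
            (\<forall>i\<in>{1..t}. \<forall>j\<in>{1..l}. cmod (\<beta> i j) = 1) \<and>
            orthonormal_basis m
              {power_product m A t p *\<^sub>v v j | p j.
                 (\<forall>i\<in>{1..t}. p i < qz_order (d i)) \<and> j \<in> {1..l}} \<and>
            (\<forall>p. \<forall>j\<in>{1..l}. (\<forall>i\<in>{1..t}. p i < qz_order (d i)) \<longrightarrow>
               (\<forall>i\<in>{t+1..2*t}.
                  eigenvector (A i) (power_product m A t p *\<^sub>v v j) (\<gamma> (i - t) ^ p (i - t) * \<alpha> i j)) \<and>
               (\<forall>i\<in>{2*t+1..n}.
                  eigenvector (A i) (power_product m A t p *\<^sub>v v j) (\<alpha> i j))) \<and>
            (\<forall>i\<in>{1..t}. \<forall>j\<in>{1..l}. (A i ^\<^sub>m qz_order (d i)) *\<^sub>v v j = \<beta> i j \<cdot>\<^sub>v v j)"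
  proof (rule exI[of _ v], rule exI[of _ \<alpha>], rule exI[of _ \<beta>], intro conjI ballI allI impI)
    fix j k assume jk: "j \<in> {1..l}" "k \<in> {1..l}"
    show "v j \<bullet>c v k = (if j = k then 1 else 0)"
      using adapted_cscalar_prod[OF v adm0 adm0 jk] unfolding translate0[OF jk(1)] translate0[OF jk(2)]
      by simp
  next
    fix i j assume ij: "i \<in> {t<..n}" "j \<in> {1..l}"
    then have "i \<in> {1..n}" by auto
    then show "cmod (\<alpha> i j) = 1"
      using unitary_eigenvalue_norm[OF unitary vm v0 \<alpha>] ij by blast
  next
    fix i j assume ij: "i \<in> {1..t}" "j \<in> {1..l}"
    then have "i \<in> {1..n}" using le by auto
    then show "cmod (\<beta> i j) = 1"
      using unitary_eigenvalue_norm[OF unitary_group_pow[OF unitary] vm v0 \<beta>] ij by blast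
  next
    fix p j i assume j: "j \<in> {1..l}" and i: "i \<in> {t + 1..2 * t}"
    then have i': "i - t \<in> {1..t}" "i - t + t = i" "i \<in> {t<..n}" "i \<in> {1..n}" using le by auto
    then have "A i *\<^sub>v translate p (v j) = (\<gamma> (i - t) ^ p (i - t) * \<alpha> i j) \<cdot>\<^sub>v translate p (v j)"
      using dual_translate[OF vm[OF j] i'(1), of "\<alpha> i j" p] \<alpha>[OF i'(3) j] assms(4) by simp
    then show "eigenvector (A i) (translate p (v j)) (\<gamma> (i - t) ^ p (i - t) * \<alpha> i j)"
      using carrier[OF i'(4)] vm[OF j] t0[OF j] by (simp add: eigenvector_def)
  next
    fix p j i assume j: "j \<in> {1..l}" and i: "i \<in> {2 * t + 1..n}"
    then have i': "i \<in> {t<..n}" "i \<in> {1..n}" by auto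
    have "A i *\<^sub>v translate p (v j) = \<alpha> i j \<cdot>\<^sub>v translate p (v j)"
    proof (rule commuting_translate[OF vm[OF j] carrier[OF i'(2)] _ \<alpha>[OF i'(1) j]])
      fix k assume "k \<in> {1..t}"
      then show "A i * A k = A k * A i"
        using i le by (intro commute) (auto simp: D_matrix_def)
    qed
    then show "eigenvector (A i) (translate p (v j)) (\<alpha> i j)"
      using carrier[OF i'(2)] vm[OF j] t0[OF j] by (simp add: eigenvector_def)
  qed (use vm \<beta> basis in auto)
qed

end
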